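(* Let $r\ge 2$ and let $a_1,\dots,a_r$ be integers with $a_i\ge 3$ for all $i$. Put $R=R(a_1,\dots,a_r)$. Then $$F_e(a_1,\dots,a_r;R-2)=R+6$$ if and only if either ($R\ge 7$ and $K_{R-7}+Q\to_e(a_1,\dots,a_r)$) or ($R\ge 9$ and $K_{R-9}+C_5+C_5+C_5\to_e(a_1,\dots,a_r)$).
   Context: All graphs are finite, simple and undirected; $\omega(G)$ denotes the clique number. For integers $a_1,\dots,a_r\ge 2$, $G\to_e(a_1,\dots,a_r)$ means: for every partition $E(G)=E_1\cup\dots\cup E_r$ of the edge set into pairwise disjoint classes there exist $i\in\{1,\dots,r\}$ and a set of $a_i$ pairwise adjacent vertices all of whose connecting edges lie in $E_i$. The Ramsey number is $R(a_1,\dots,a_r)=\min\{n: K_n\to_e(a_1,\dots,a_r)\}$. The edge Folkman number is $F_e(a_1,\dots,a_r;q)=\min\{|V(G)|: G\to_e(a_1,\dots,a_r)\text{ and }\omega(G)<q\}$. $K_n$ is the complete graph on $n$ vertices ($K_0+H=H$), $C_5$ is the 5-cycle, and $G_1+G_2$ is the join (disjoint union of $G_1$ and $G_2$ plus all edges between $V(G_1)$ and $V(G_2)$). $Q$ is the graph on $\mathbb{Z}_{13}$ in which distinct $i,j$ are adjacent iff $i-j\notin\{\pm1,\pm5\}\pmod{13}$ (its complement is the circulant graph on $\mathbb{Z}_{13}$ with connection set $\{\pm1,\pm5\}$). *)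

theory Defs
  imports
    "HOL-Library.Ramsey"
    "HOL-Library.Extended_Nat"
    "HOL-Library.Disjoint_Sets"
    "HOL-Number_Theory.Cong"
begin

text \<open>A graph is a pair of a vertex set and a set of edges, an edge being a two-element
  set of vertices.  Cliques are those of \<^theory>\<open>HOL-Library.Ramsey\<close>.\<close>

type_synonym 'a ugraph = "'a set \<times> 'a set set"

abbreviation verts :: "'a ugraph \<Rightarrow> 'a set" where
  "verts G \<equiv> fst G"

abbreviation edges :: "'a ugraph \<Rightarrow> 'a set set" where
  "edges G \<equiv> snd G"

definition simple_graph :: "'a ugraph \<Rightarrow> bool" where
  "simple_graph G \<longleftrightarrow> finite (verts G) \<and> edges G \<subseteq> [verts G]\<^bsup>2\<^esup>"

definition clique_number :: "'a ugraph \<Rightarrow> nat" where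
  "clique_number G = Max {card S |S. S \<subseteq> verts G \<and> clique S (edges G)}"

text \<open>The classes of a partition of the edge set are indexed by the positions of the list
  \<open>as\<close>; as usual for colourings, a class may be empty.\<close>

definition edge_arrows :: "'a ugraph \<Rightarrow> nat list \<Rightarrow> bool" (infix \<open>\<rightarrow>\<^sub>e\<close> 50) where
  "G \<rightarrow>\<^sub>e as \<longleftrightarrow>
     (\<forall>P :: nat \<Rightarrow> 'a set set.
        (\<Union>i<length as. P i) = edges G \<and> disjoint_family_on P {..<length as} \<longrightarrow>
        (\<exists>i<length as. \<exists>S\<subseteq>verts G. card S = as ! i \<and> clique S (P i)))"

definition complete_graph :: "nat \<Rightarrow> nat ugraph" where
  "complete_graph n = ({..<n}, [{..<n}]\<^bsup>2\<^esup>)"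

definition cycle5 :: "nat ugraph" where
  "cycle5 = ({..<5}, {{i, (i + 1) mod 5} |i. i < 5})"

definition graph_Q :: "int ugraph" where
  "graph_Q = ({0..<13},
     {{i, j} |i j. i \<in> {0..<13} \<and> j \<in> {0..<13} \<and> i \<noteq> j \<and>
                   (\<forall>c\<in>{1, -1, 5, -5}. \<not> [i - j = c] (mod 13))})"

definition join :: "'a ugraph \<Rightarrow> 'b ugraph \<Rightarrow> ('a + 'b) ugraph" (infixr \<open>\<oplus>\<^sub>g\<close> 65) where
  "G \<oplus>\<^sub>g H =
     (verts G <+> verts H,
      (`) Inl ` edges G \<union> (`) Inr ` edges H \<union> {{Inl u, Inr v} |u v. u \<in> verts G \<and> v \<in> verts H})"

definition ramsey_number :: "nat list \<Rightarrow> nat" where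
  "ramsey_number as = (LEAST n. complete_graph n \<rightarrow>\<^sub>e as)"

text \<open>The minimum may be taken over graphs whose vertices are natural numbers, since every
  finite graph is isomorphic to one of these.  Its value is \<open>\<infinity>\<close> if there is no such graph.\<close>

definition folkman_number :: "nat list \<Rightarrow> nat \<Rightarrow> enat" where
  "folkman_number as q =
     (INF G \<in> {G :: nat ugraph. simple_graph G \<and> G \<rightarrow>\<^sub>e as \<and> clique_number G < q}.
        enat (card (verts G)))"

text \<open>By Ramsey's theorem the minimum defining \<^const>\<open>ramsey_number\<close> is attained.\<close>

lemma complete_graph_arrows_ex: "\<exists>n. complete_graph n \<rightarrow>\<^sub>e as"
proof -
  obtain n :: nat where n: "partn_lst {..<n} as 2"
    using ramsey_full by blast
  have "complete_graph n \<rightarrow>\<^sub>e as"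
    unfolding edge_arrows_def
  proof (intro allI impI, elim conjE)
    fix P :: "nat \<Rightarrow> nat set set"
    assume U: "(\<Union>i<length as. P i) = edges (complete_graph n)"
    define f where "f e = (SOME i. i < length as \<and> e \<in> P i)" for e
    have f: "f e < length as \<and> e \<in> P (f e)" if "e \<in> [{..<n}]\<^bsup>2\<^esup>" for e
    proof -
      have "\<exists>i. i < length as \<and> e \<in> P i"
        using that U by (auto simp: complete_graph_def)
      then show ?thesis unfolding f_def by (rule someI_ex)
    qed
    then have "f \<in> [{..<n}]\<^bsup>2\<^esup> \<rightarrow> {..<length as}" by auto
    then obtain i H where i: "i < length as" and H: "H \<in> nsets {..<n} (as ! i)"
      and fH: "f ` [H]\<^bsup>2\<^esup> \<subseteq> {i}"
      using partn_lstE[OF n] by metis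
    have sub: "H \<subseteq> {..<n}" and card: "card H = as ! i"
      using H by (auto simp: nsets_def)
    have "clique H (P i)"
      unfolding clique_def
    proof (intro ballI impI)
      fix v w assume "v \<in> H" "w \<in> H" "v \<noteq> w"
      then have vw: "{v, w} \<in> [H]\<^bsup>2\<^esup>" by simp
      then have "f {v, w} = i" using fH by blast
      moreover have "{v, w} \<in> [{..<n}]\<^bsup>2\<^esup>" using vw nsets_mono[OF sub] by blast
      ultimately show "{v, w} \<in> P i" using f by blast
    qed
    then show "\<exists>i<length as. \<exists>S\<subseteq>verts (complete_graph n). card S = as ! i \<and> clique S (P i)"
      using i sub card by (auto simp: complete_graph_def)
  qed
  then show ?thesis ..
qed

lemma ramsey_number_arrows: "complete_graph (ramsey_number as) \<rightarrow>\<^sub>e as"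
  unfolding ramsey_number_def using complete_graph_arrows_ex by (rule LeastI_ex)

lemma simple_graph_complete_graph: "simple_graph (complete_graph n)"
  by (simp add: simple_graph_def complete_graph_def)

lemma simple_graph_cycle5: "simple_graph cycle5"
proof -
  have "i \<noteq> (i + 1) mod 5" if "i < 5" for i :: nat
    using that by presburger
  then show ?thesis
    by (auto simp: simple_graph_def cycle5_def)
qed

lemma simple_graph_graph_Q: "simple_graph graph_Q"
  by (auto simp: simple_graph_def graph_Q_def)

lemma simple_graph_join:
  assumes "simple_graph G" "simple_graph H"
  shows "simple_graph (G \<oplus>\<^sub>g H)"
proof -
  have "(`) Inl ` edges G \<subseteq> [verts G <+> verts H]\<^bsup>2\<^esup>"
  proof clarify
    fix e assume "e \<in> edges G"
    then have "e \<in> [verts G]\<^bsup>2\<^esup>" using assms by (auto simp: simple_graph_def)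
    then show "Inl ` e \<in> [verts G <+> verts H]\<^bsup>2\<^esup>" by (auto elim!: nsets2_E)
  qed
  moreover have "(`) Inr ` edges H \<subseteq> [verts G <+> verts H]\<^bsup>2\<^esup>"
  proof clarify
    fix e assume "e \<in> edges H"
    then have "e \<in> [verts H]\<^bsup>2\<^esup>" using assms by (auto simp: simple_graph_def)
    then show "Inr ` e \<in> [verts G <+> verts H]\<^bsup>2\<^esup>" by (auto elim!: nsets2_E)
  qed
  moreover have "{{Inl u, Inr v} |u v. u \<in> verts G \<and> v \<in> verts H} \<subseteq> [verts G <+> verts H]\<^bsup>2\<^esup>"
    by auto
  ultimately show ?thesis
    using assms by (simp add: simple_graph_def join_def)
qed

end

theory Submission
  imports Defs
begin

text \<open>A colouring of \<open>G\<close> with fewer than \<open>R\<close> colours is a homomorphism into \<open>K\<^sub>n\<close> with \<open>n < R\<close>, so a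
  graph \<open>G\<close> that arrows has chromatic number at least \<open>R\<close>.  Hence it suffices that a graph whose chromatic
  number exceeds its clique number by at least \<open>3\<close> has at least \<open>6\<close> more vertices than colours, with equality
  only for the two families in the theorem.  More generally, with excess \<open>c \<le> 3\<close> there are \<open>2 c\<close> more
  vertices than colours, with equality only if the complement \<open>H\<close> consists of \<open>c\<close> pentagons (or, for \<open>c = 3\<close>,
  of the complement of \<open>Q\<close>) and isolated vertices.

  This is shown by induction on the number of vertices.  A triangle of \<open>H\<close> can be removed, which lowers both
  the number of colours and the excess by one, and the structure of the remainder leads to a contradiction.
  If \<open>H\<close> is triangle-free, then colourings of \<open>G\<close> are matchings of \<open>H\<close>, Gallai's lemma splits a critical
  \<open>H\<close> into parts with near-perfect matchings, and Ramsey's theorem for \<open>(3,3)\<close> and \<open>(3,4)\<close> together with the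
  uniqueness of the Ramsey graph for \<open>(3,5)\<close> on 13 vertices bounds the excess of each part.\<close>

text \<open>The obstacle is the triangles of \<open>H\<close>: they allow colour classes with three
  vertices, so that colouring is no longer a matching problem. Removing a triangle takes away three
  vertices, while \<open>k + 2 * c\<close> loses one through \<open>k\<close> and two through
  \<open>c\<close>. The induction therefore closes without any slack: equality for the remainder
  gives equality for the whole, and the remainder is known completely. As its excess is at most two,
  only pentagons occur in it, never the piece on 13 vertices. The restriction to excess at most
  three keeps the matching number at most 6, hence the parts of Gallai's lemma at most 13 vertices
  large. The two families tie because \<open>Q\<close> has chromatic number 7 and clique number 4,
  while three pentagons have 9 and 6: the excess is three in both cases, and so is 6 the number of
  vertices beyond the number of colours (13 - 7 and 15 - 9). Conversely, both graphs of the theorem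
  have \<open>R + 6\<close> vertices and cliques of at most \<open>R - 3\<close> vertices, so either
  of them is a witness as soon as it arrows.\<close>

lemma sum_bool_card: "finite A \<Longrightarrow> (\<Sum>x\<in>A. if P x then 1 else 0) = card {x\<in>A. P x}"
  by (simp add: sum.If_cases Int_def)

text \<open>In the application \<open>E\<close> is the nonadjacency relation of a graph \<open>G\<close>, so that stable sets
  are the cliques of \<open>G\<close>, and \<open>ccol A m\<close> says that \<open>A\<close> can be properly coloured with \<open>m\<close> colours in \<open>G\<close>.\<close>

locale nonadjacency =
  fixes E :: "'a \<Rightarrow> 'a \<Rightarrow> bool"
  assumes sym: "E u v \<Longrightarrow> E v u" and irrefl: "\<not> E u u"
begin

lemma neqI: "E u v \<Longrightarrow> u \<noteq> v" using irrefl by blast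

definition stable :: "'a set \<Rightarrow> bool" where
  "stable S \<longleftrightarrow> (\<forall>u\<in>S. \<forall>v\<in>S. \<not> E u v)"

definition ccol :: "'a set \<Rightarrow> nat \<Rightarrow> bool" where
  "ccol A m \<longleftrightarrow> (\<exists>f. f ` A \<subseteq> {..<m} \<and> (\<forall>u\<in>A. \<forall>v\<in>A. f u = f v \<longrightarrow> u = v \<or> E u v))"

definition triangle_free :: "'a set \<Rightarrow> bool" where
  "triangle_free V \<longleftrightarrow> (\<forall>x\<in>V. \<forall>y\<in>V. \<forall>z\<in>V. \<not> (E x y \<and> E y z \<and> E x z))"

lemma tfreeD: "triangle_free V \<Longrightarrow> x \<in> V \<Longrightarrow> y \<in> V \<Longrightarrow> z \<in> V \<Longrightarrow> E x y \<Longrightarrow> E y z \<Longrightarrow> \<not> E x z"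
  unfolding triangle_free_def by metis

lemma ccol_empty: "ccol {} 0"
  by (simp add: ccol_def)

lemma ccol_mono: "ccol A m \<Longrightarrow> B \<subseteq> A \<Longrightarrow> m \<le> n \<Longrightarrow> ccol B n"
  unfolding ccol_def
proof (elim exE conjE, intro exI conjI)
  fix f assume "f ` A \<subseteq> {..<m}" "B \<subseteq> A" "m \<le> n"
  then have "f ` B \<subseteq> {..<m}" "{..<m} \<subseteq> {..<n}" by auto
  then show "f ` B \<subseteq> {..<n}" by (rule subset_trans)
qed auto

lemma ccol_Un:
  assumes "ccol A m" "ccol B n" shows "ccol (A \<union> B) (m + n)"
proof -
  obtain f g where f: "f ` A \<subseteq> {..<m}" "\<And>u v. u \<in> A \<Longrightarrow> v \<in> A \<Longrightarrow> f u = f v \<Longrightarrow> u = v \<or> E u v"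
    and g: "g ` B \<subseteq> {..<n}" "\<And>u v. u \<in> B \<Longrightarrow> v \<in> B \<Longrightarrow> g u = g v \<Longrightarrow> u = v \<or> E u v"
    using assms unfolding ccol_def by metis
  define h where "h x = (if x \<in> A then f x else m + g x)" for x
  have "h ` (A \<union> B) \<subseteq> {..<m+n}"
    using f(1) g(1) by (auto simp: h_def image_subset_iff trans_less_add1)
  moreover have "u = v \<or> E u v" if "u \<in> A \<union> B" "v \<in> A \<union> B" "h u = h v" for u v
  proof (cases "u \<in> A"; cases "v \<in> A")
    assume "u \<in> A" "v \<in> A" then show ?thesis using that f by (simp add: h_def)
  next
    assume "u \<in> A" "v \<notin> A" then show ?thesis using that f(1) by (fastforce simp: h_def image_subset_iff)
  next
    assume "u \<notin> A" "v \<in> A" then show ?thesis using that f(1) by (fastforce simp: h_def image_subset_iff)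
  next
    assume "u \<notin> A" "v \<notin> A" then show ?thesis using that g(2) by (simp add: h_def)
  qed
  ultimately show ?thesis unfolding ccol_def by blast
qed

lemma ccol_clique: "(\<And>u v. u \<in> A \<Longrightarrow> v \<in> A \<Longrightarrow> u = v \<or> E u v) \<Longrightarrow> ccol A 1"
  unfolding ccol_def by (rule exI[of _ "\<lambda>_. 0"]) auto

lemma ccol_UN:
  assumes "finite I" "\<And>i. i \<in> I \<Longrightarrow> ccol (g i) (h i)"
  shows "ccol (\<Union>i\<in>I. g i) (\<Sum>i\<in>I. h i)"
  using assms
proof (induction I rule: finite_induct)
  case empty then show ?case by (simp add: ccol_empty)
next
  case (insert i I) then show ?case using ccol_Un[of "g i" "h i"] by simp
qed

lemma ccol_card: "finite A \<Longrightarrow> ccol A (card A)"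
  using ccol_UN[of A "\<lambda>x. {x}" "\<lambda>_. 1"] ccol_clique[of "{_}"] by simp

section \<open>Matchings, and colourings with classes of at most two vertices\<close>

definition matching :: "'a set \<Rightarrow> 'a set set \<Rightarrow> bool" where
  "matching V M \<longleftrightarrow> (\<forall>e\<in>M. \<exists>u v. e = {u, v} \<and> u \<in> V \<and> v \<in> V \<and> E u v) \<and> disjoint M"

lemma matchingD: "matching V M \<Longrightarrow> e \<in> M \<Longrightarrow> \<exists>u v. e = {u, v} \<and> u \<in> V \<and> v \<in> V \<and> E u v"
  by (simp add: matching_def)

lemma matching_disjD: "matching V M \<Longrightarrow> e \<in> M \<Longrightarrow> f \<in> M \<Longrightarrow> x \<in> e \<Longrightarrow> x \<in> f \<Longrightarrow> e = f"
  unfolding matching_def disjoint_def by (elim conjE) (metis IntI empty_iff)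

lemma matching_mono:
  assumes "matching A M" "A \<subseteq> V" "N \<subseteq> M" shows "matching V N"
proof -
  have "\<exists>u v. e = {u, v} \<and> u \<in> V \<and> v \<in> V \<and> E u v" if "e \<in> N" for e
    using matchingD[OF assms(1), of e] that assms(2,3) by (meson subsetD)
  moreover have "disjoint N" using assms(1,3) unfolding matching_def disjoint_def by (meson subsetD)
  ultimately show ?thesis unfolding matching_def by simp
qed

lemma matching_Union: "matching V M \<Longrightarrow> \<Union>M \<subseteq> V"
  using matchingD by fastforce

lemma matching_card_edge: "matching V M \<Longrightarrow> e \<in> M \<Longrightarrow> card e = 2"
  using matchingD[of V M e] irrefl by (auto simp: card_insert_if)

lemma matching_finite: "matching V M \<Longrightarrow> finite V \<Longrightarrow> finite M"
  using matching_Union finite_UnionD finite_subset by metis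

lemma matching_card_Union:
  assumes "matching V M" "finite V" shows "card (\<Union>M) = 2 * card M"
proof -
  have "card (\<Union>M) = (\<Sum>e\<in>M. card e)"
    using assms by (intro card_Union_disjoint)
      (auto simp: matching_def disjoint_def pairwise_def disjnt_def)
  then show ?thesis using matching_card_edge[OF assms(1)] by simp
qed

lemma matching_insert:
  assumes "matching V M" "E u v" "u \<in> V" "v \<in> V" "u \<notin> \<Union>M" "v \<notin> \<Union>M"
  shows "matching V (insert {u, v} M)" "{u, v} \<notin> M"
proof -
  show "{u, v} \<notin> M" using assms(5) by blast
  have "disjoint (insert {u, v} M)"
    unfolding disjoint_def
  proof (intro ballI impI)
    fix e f assume "e \<in> insert {u, v} M" "f \<in> insert {u, v} M" "e \<noteq> f"
    then show "e \<inter> f = {}"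
      using assms(5,6) matching_disjD[OF assms(1), of e f] by (elim insertE) auto
  qed
  moreover have "\<exists>p q. e = {p, q} \<and> p \<in> V \<and> q \<in> V \<and> E p q" if "e \<in> insert {u, v} M" for e
  proof (cases "e \<in> M")
    case True then show ?thesis by (rule matchingD[OF assms(1)])
  next
    case False then show ?thesis using that assms(2-4) by auto
  qed
  ultimately show "matching V (insert {u, v} M)" unfolding matching_def by simp
qed

text \<open>Each matching edge serves as one colour class and saves one colour against giving every
  vertex a colour of its own.\<close>

lemma ccol_matching:
  assumes "matching V M" "finite V" shows "ccol V (card V - card M)"
proof -
  have "ccol (\<Union>e\<in>M. e) (\<Sum>e\<in>M. 1)"
  proof (rule ccol_UN[OF matching_finite[OF assms]])
    fix e assume "e \<in> M"
    then obtain u v where "e = {u,v}" "E u v" using matchingD[OF assms(1)] by blast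
    then show "ccol e 1" using sym by (intro ccol_clique) auto
  qed
  moreover have "ccol (V - \<Union>M) (card (V - \<Union>M))" using assms(2) by (simp add: ccol_card)
  ultimately have "ccol (\<Union>M \<union> (V - \<Union>M)) (card M + card (V - \<Union>M))"
    using ccol_Un by fastforce
  moreover have "card (V - \<Union>M) = card V - 2 * card M"
    using matching_card_Union[OF assms] matching_Union[OF assms(1)] assms(2)
    by (simp add: card_Diff_subset finite_subset)
  moreover have "2 * card M \<le> card V"
    using matching_card_Union[OF assms] matching_Union[OF assms(1)] assms(2) card_mono by metis
  ultimately show ?thesis by (auto elim!: ccol_mono)
qed

lemma triangle_free_mono: "triangle_free V \<Longrightarrow> A \<subseteq> V \<Longrightarrow> triangle_free A"
  unfolding triangle_free_def by blast

lemma stable_mono: "stable V \<Longrightarrow> A \<subseteq> V \<Longrightarrow> stable A"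
  unfolding stable_def by blast

text \<open>Colour classes are cliques of \<open>E\<close>, so without triangles they have at most
  two elements. The classes of size two form the matching, and a class contributes at most one
  vertex beyond its colour unless it is such an edge.\<close>

lemma matching_of_ccol:
  assumes "ccol A m" "triangle_free A" "finite A"
  shows "\<exists>M. matching A M \<and> card A \<le> m + card M"
proof -
  obtain f where f: "f ` A \<subseteq> {..<m}" "\<And>u v. u \<in> A \<Longrightarrow> v \<in> A \<Longrightarrow> f u = f v \<Longrightarrow> u = v \<or> E u v"
    using assms(1) unfolding ccol_def by metis
  define F where "F i = {x\<in>A. f x = i}" for i
  define I where "I = {i. i < m \<and> card (F i) = 2}"
  have finF: "finite (F i)" for i using assms(3) by (simp add: F_def)
  have le2: "card (F i) \<le> 2" for i
  proof (rule ccontr)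
    assume "\<not> card (F i) \<le> 2"
    then have "3 \<le> card (F i)" by simp
    then obtain T where "T \<subseteq> F i" "card T = 3" by (meson obtain_subset_with_card_n)
    then obtain x y z where "x \<in> F i" "y \<in> F i" "z \<in> F i" "x \<noteq> y" "x \<noteq> z" "y \<noteq> z"
      by (auto simp: card_3_iff)
    then have "E x y" "E y z" "E x z" "x \<in> A" "y \<in> A" "z \<in> A"
      using f(2)[of x y] f(2)[of y z] f(2)[of x z] by (auto simp: F_def)
    then show False using tfreeD[OF assms(2), of x y z] by simp
  qed
  have "card A = card (\<Union>i\<in>{..<m}. F i)"
    using f(1) by (intro arg_cong[of _ _ card]) (auto simp: F_def)
  also have "\<dots> = (\<Sum>i<m. card (F i))"
    by (rule card_UN_disjoint) (auto simp: finF, auto simp: F_def)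
  also have "\<dots> \<le> (\<Sum>i<m. 1 + (if card (F i) = 2 then 1 else 0))"
  proof (rule sum_mono)
    fix i show "card (F i) \<le> 1 + (if card (F i) = 2 then 1 else 0)" using le2[of i] by auto
  qed
  also have "\<dots> = m + card I"
    by (simp only: sum.distrib sum_bool_card finite_lessThan) (simp add: I_def)
  finally have c: "card A \<le> m + card I" .
  have "inj_on F I"
  proof (rule inj_onI)
    fix i j assume "i \<in> I" "j \<in> I" and eq: "F i = F j"
    then have "F i \<noteq> {}" by (auto simp: I_def)
    then show "i = j" using eq by (auto simp: F_def)
  qed
  then have "card (F ` I) = card I" by (rule card_image)
  moreover have "matching A (F ` I)"
    unfolding matching_def
  proof (intro conjI ballI)
    fix e assume "e \<in> F ` I"
    then obtain i where e: "e = F i" "card (F i) = 2" by (auto simp: I_def)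
    then obtain u v where uv: "F i = {u,v}" "u \<noteq> v" by (auto simp: card_2_iff)
    then have "u \<in> F i" "v \<in> F i" by auto
    then have "u \<in> A" "v \<in> A" "f u = f v" by (auto simp: F_def)
    then show "\<exists>u v. e = {u, v} \<and> u \<in> A \<and> v \<in> A \<and> E u v" using uv e f(2) by blast
  next
    show "disjoint (F ` I)" by (auto simp: disjoint_def F_def)
  qed
  ultimately show ?thesis using c by metis
qed

subsection \<open>Gallai's lemma\<close>

lemma gallai_trans:
  assumes fin: "finite V"
    and max: "\<And>M. matching V M \<Longrightarrow> card M \<le> \<nu>"
    and miss: "\<And>v. v \<in> V \<Longrightarrow> \<exists>M. matching V M \<and> card M = \<nu> \<and> v \<notin> \<Union>M"
    and V: "u \<in> V" "t \<in> V" "v \<in> V"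
    and ut: "\<And>M. matching V M \<Longrightarrow> card M = \<nu> \<Longrightarrow> u \<in> \<Union>M \<or> t \<in> \<Union>M"
    and tv: "\<And>M. matching V M \<Longrightarrow> card M = \<nu> \<Longrightarrow> t \<in> \<Union>M \<or> v \<in> \<Union>M"
    and M: "matching V M" "card M = \<nu>" and uv: "u \<noteq> v"
  shows "u \<in> \<Union>M \<or> v \<in> \<Union>M"
proof (rule ccontr)
  assume nuv: "\<not> (u \<in> \<Union>M \<or> v \<in> \<Union>M)"
  txt \<open>Among the maximum matchings missing \<open>t\<close> choose one with the largest intersection with \<open>M\<close>;
    exchanging a single edge then increases the intersection.\<close>
  define \<N> where "\<N> N \<longleftrightarrow> matching V N \<and> card N = \<nu> \<and> t \<notin> \<Union>N" for N
  have finM: "finite M" using matching_finite[OF M(1) fin] .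
  obtain N0 where "\<N> N0" using miss[OF V(2)] unfolding \<N>_def by blast
  moreover have "\<And>N. \<N> N \<Longrightarrow> card (M \<inter> N) \<le> card M"
    using finM by (simp add: card_mono)
  ultimately obtain N where N: "\<N> N" and best: "\<And>N'. \<N> N' \<Longrightarrow> card (M \<inter> N') \<le> card (M \<inter> N)"
    using ex_has_greatest_nat[of \<N> N0 "\<lambda>N. card (M \<inter> N)" "Suc (card M)"] by (metis le_imp_less_Suc)
  have mN: "matching V N" and cN: "card N = \<nu>" and tN: "t \<notin> \<Union>N" using N by (auto simp: \<N>_def)
  have cov: "u \<in> \<Union>N" "v \<in> \<Union>N" using ut[OF mN cN] tv[OF mN cN] tN by blast+
  have fU: "finite (\<Union>M)" "finite (\<Union>N)"
    using matching_Union M(1) mN fin finite_subset by metis+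
  have eq: "card (\<Union>M) = card (\<Union>N)"
    using matching_card_Union[OF M(1) fin] matching_card_Union[OF mN fin] M(2) cN by simp
  \<comment> \<open>\<open>M\<close> and \<open>N\<close> cover equally many vertices, and
    \<open>N\<close> covers \<open>u\<close> and \<open>v\<close>, which \<open>M\<close> misses. So
    \<open>M\<close> covers two vertices that \<open>N\<close> misses, and one of them differs from
    \<open>t\<close>.\<close>
  have "card {u, v} \<le> card (\<Union>N - \<Union>M)"
    using cov nuv fU by (intro card_mono) auto
  also have "\<dots> = card (\<Union>M - \<Union>N)"
    using eq fU by (metis card_le_sym_Diff le_antisym order_refl)
  finally have "2 \<le> card (\<Union>M - \<Union>N)" using uv by simp
  then have "\<not> (\<Union>M - \<Union>N \<subseteq> {t})"
    using card_mono[of "{t}" "\<Union>M - \<Union>N"] by auto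
  then obtain x where x: "x \<in> \<Union>M" "x \<notin> \<Union>N" "x \<noteq> t" by blast
  then obtain e where e: "e \<in> M" "x \<in> e" by blast
  then obtain y where exy: "e = {x, y}" "E x y" "x \<in> V" "y \<in> V"
    using matchingD[OF M(1) e(1)] sym by (metis insert_iff doubleton_eq_iff singletonD)
  have "y \<in> \<Union>N"
  proof (rule ccontr)
    assume "y \<notin> \<Union>N"
    then have "matching V (insert {x,y} N)" "{x,y} \<notin> N"
      using matching_insert[OF mN exy(2-4) x(2)] by auto
    then show False using max[of "insert {x,y} N"] cN matching_finite[OF mN fin] by simp
  qed
  then obtain f where f: "f \<in> N" "y \<in> f" by blast
  \<comment> \<open>Exchanging \<open>f\<close> for \<open>{x, y}\<close> keeps the size, gains the
    edge \<open>e\<close> of \<open>M\<close> and loses no edge of \<open>M\<close>. The vertex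
    \<open>t\<close> stays missed: it is not \<open>x\<close> by choice, and not \<open>y\<close>
    because \<open>N\<close> covers \<open>y\<close>.\<close>
  define N' where "N' = insert {x, y} (N - {f})"
  have m0: "matching V (N - {f})" by (rule matching_mono[OF mN]) auto
  have x0: "x \<notin> \<Union>(N - {f})" using x(2) by blast
  have y0: "y \<notin> \<Union>(N - {f})" using f matching_disjD[OF mN] by blast
  have m1: "matching V N'" "{x,y} \<notin> N - {f}"
    using matching_insert[OF m0 exy(2-4) x0 y0] by (auto simp: N'_def)
  have "card N' = Suc (card (N - {f}))" using m1(2) matching_finite[OF mN fin]
    unfolding N'_def by (intro card_insert_disjoint) auto
  then have "card N' = \<nu>" using card.remove[OF matching_finite[OF mN fin] f(1)] cN by simp
  moreover have "t \<notin> \<Union>N'" using x(3) tN \<open>y \<in> \<Union>N\<close> by (auto simp: N'_def)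
  ultimately have "\<N> N'" using m1(1) by (simp add: \<N>_def)
  have "f \<notin> M"
  proof
    assume "f \<in> M"
    then have "f = e" using matching_disjD[OF M(1)] e exy f by blast
    then show False using f e x by blast
  qed
  then have "insert e (M \<inter> N) \<subseteq> M \<inter> N'" using e exy by (auto simp: N'_def)
  moreover have "e \<notin> M \<inter> N" using x e by blast
  ultimately have "card (M \<inter> N) < card (M \<inter> N')"
    using finM by (intro psubset_card_mono) auto
  then show False using best[OF \<open>\<N> N'\<close>] by simp
qed

lemma gallai_partition:
  assumes fin: "finite V"
    and max: "\<And>M. matching V M \<Longrightarrow> card M \<le> \<nu>"
    and miss: "\<And>v. v \<in> V \<Longrightarrow> \<exists>M. matching V M \<and> card M = \<nu> \<and> v \<notin> \<Union>M"
    and ex: "\<exists>M. matching V M \<and> card M = \<nu>"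
  shows "\<exists>\<C>. \<Union>\<C> = V \<and> disjoint \<C> \<and> {} \<notin> \<C> \<and> (\<forall>C\<in>\<C>. odd (card C))
    \<and> (\<forall>u\<in>V. \<forall>v\<in>V. E u v \<longrightarrow> (\<exists>C\<in>\<C>. u \<in> C \<and> v \<in> C)) \<and> card V = 2 * \<nu> + card \<C>"
proof -
  txt \<open>By transitivity, ``no maximum matching misses both'' is an equivalence relation; its classes
    contain every edge, and a maximum matching misses exactly one vertex of each.\<close>
  define r where "r = {(u, v). u \<in> V \<and> v \<in> V \<and> (u = v \<or>
    (\<forall>M. matching V M \<longrightarrow> card M = \<nu> \<longrightarrow> u \<in> \<Union>M \<or> v \<in> \<Union>M))}"
  have eqv: "equiv V r"
  proof (rule equivI)
    show "r \<subseteq> V \<times> V" "refl_on V r" by (auto simp: r_def refl_on_def)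
    show "sym r" unfolding sym_on_def by (auto simp: r_def)
    show "trans r"
    proof (rule transI)
      fix u t v assume ut: "(u, t) \<in> r" and tv: "(t, v) \<in> r"
      show "(u, v) \<in> r"
      proof (cases "u = t \<or> t = v \<or> u = v")
        case True then show ?thesis using ut tv by (auto simp: r_def)
      next
        case False
        then have V: "u \<in> V" "t \<in> V" "v \<in> V"
          and 1: "\<And>M. matching V M \<Longrightarrow> card M = \<nu> \<Longrightarrow> u \<in> \<Union>M \<or> t \<in> \<Union>M"
          and 2: "\<And>M. matching V M \<Longrightarrow> card M = \<nu> \<Longrightarrow> t \<in> \<Union>M \<or> v \<in> \<Union>M"
          using ut tv by (simp_all add: r_def del: Union_iff)
        have "u \<in> \<Union>M \<or> v \<in> \<Union>M" if "matching V M" "card M = \<nu>" for M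
          using gallai_trans[of V \<nu>, OF fin max miss V 1 2 that] False by blast
        then show ?thesis using V by (simp add: r_def del: Union_iff)
      qed
    qed
  qed
  define \<C> where "\<C> = V // r"
  have U: "\<Union>\<C> = V" unfolding \<C>_def by (rule Union_quotient[OF eqv])
  have d: "disjoint \<C>" using quotient_disj[OF eqv] unfolding \<C>_def disjoint_def by blast
  have ne: "{} \<notin> \<C>" using in_quotient_imp_non_empty[OF eqv] unfolding \<C>_def by blast
  have rel: "(u, v) \<in> r" if "C \<in> \<C>" "u \<in> C" "v \<in> C" for C u v
    using quotient_eq_iff[OF eqv, of C C u v] that by (simp add: \<C>_def)
  have edge: "\<exists>C\<in>\<C>. u \<in> C \<and> v \<in> C" if uv: "u \<in> V" "v \<in> V" "E u v" for u v
  proof -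
    have "(u, v) \<in> r"
    proof -
      have "u \<in> \<Union>M \<or> v \<in> \<Union>M" if M: "matching V M" "card M = \<nu>" for M
      proof (rule ccontr)
        assume "\<not> ?thesis"
        then have "matching V (insert {u,v} M)" "{u,v} \<notin> M"
          using matching_insert[OF M(1) uv(3,1,2)] by auto
        then show False using max[of "insert {u,v} M"] M(2) matching_finite[OF M(1) fin] by simp
      qed
      then show ?thesis using uv by (auto simp: r_def)
    qed
    then show ?thesis using uv eqv
      by (metis \<C>_def equiv_class_self quotientI Image_singleton_iff)
  qed
  \<comment> \<open>Matching edges stay within a class, so a matching covers an even number of
    vertices of each class, and by definition of \<open>r\<close> a maximum one misses at most one
    of them. A maximum matching that misses a vertex of \<open>C\<close> thus shows that
    \<open>card C\<close> is odd; oddness in turn makes every maximum matching miss exactly one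
    vertex of \<open>C\<close>.\<close>
  have inC: "e \<subseteq> C" if M: "matching V M" "e \<in> M" "C \<in> \<C>" "e \<inter> C \<noteq> {}" for M e C
  proof -
    obtain u v where e: "e = {u,v}" "u \<in> V" "v \<in> V" "E u v" using matchingD M by blast
    obtain D where D: "D \<in> \<C>" "u \<in> D" "v \<in> D" using edge e by blast
    have "D = C" using d D M e unfolding disjoint_def by blast
    then show ?thesis using D e by simp
  qed
  have finC: "finite C" if "C \<in> \<C>" for C using that U fin by (metis Union_upper finite_subset)
  have even: "even (card (C \<inter> \<Union>M))" if M: "matching V M" "C \<in> \<C>" for M C
  proof -
    have "C \<inter> \<Union>M = \<Union>{e\<in>M. e \<subseteq> C}" using inC[OF M(1) _ M(2)] by blast
    moreover have "matching V {e\<in>M. e \<subseteq> C}" by (rule matching_mono[OF M(1)]) auto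
    ultimately show ?thesis using matching_card_Union[OF _ fin] by simp
  qed
  have le1: "card (C - \<Union>M) \<le> 1" if M: "matching V M" "card M = \<nu>" "C \<in> \<C>" for M C
  proof -
    have "x = y" if "x \<in> C - \<Union>M" "y \<in> C - \<Union>M" for x y
      using rel[OF M(3), of x y] that M by (auto simp: r_def simp del: Union_iff)
    then show ?thesis using finC[OF M(3)] by (metis card_le_Suc0_iff_eq finite_Diff One_nat_def)
  qed
  have split: "card C = card (C \<inter> \<Union>M) + card (C - \<Union>M)" if "C \<in> \<C>" for C M
    using finC[OF that] by (metis card_Int_Diff)
  have odd: "odd (card C)" if C: "C \<in> \<C>" for C
  proof -
    obtain v where v: "v \<in> C" using ne C by (metis equals0I)
    then have "v \<in> V" using U C by blast
    then obtain M where M: "matching V M" "card M = \<nu>" "v \<notin> \<Union>M" using miss by blast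
    have "v \<in> C - \<Union>M" using v M by blast
    then have "card (C - \<Union>M) \<noteq> 0" using finC[OF C] by (metis card_eq_0_iff empty_iff finite_Diff)
    then have "card (C - \<Union>M) = 1" using le1[OF M(1,2) C] by simp
    then show ?thesis using split[OF C, of M] even[OF M(1) C] by simp
  qed
  obtain M where M: "matching V M" "card M = \<nu>" using ex by blast
  have one: "card (C - \<Union>M) = 1" if "C \<in> \<C>" for C
    using odd[OF that] split[OF that, of M] even[OF M(1) that] le1[OF M that]
    by (cases "card (C - \<Union>M)") auto
  have finCC: "finite \<C>" using U fin finite_UnionD by metis
  have "card (V - \<Union>M) = card (\<Union>C\<in>\<C>. C - \<Union>M)" using U by (intro arg_cong[of _ _ card]) blast
  also have "\<dots> = (\<Sum>C\<in>\<C>. card (C - \<Union>M))"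
    using finCC finC d by (intro card_UN_disjoint) (auto simp: disjoint_def)
  also have "\<dots> = card \<C>" using one by simp
  finally have "card (V - \<Union>M) = card \<C>" .
  moreover have "card V = card (\<Union>M) + card (V - \<Union>M)"
    using matching_Union[OF M(1)] fin by (metis card_Int_Diff inf.absorb_iff2)
  ultimately have "card V = 2 * \<nu> + card \<C>" using matching_card_Union[OF M(1) fin] M(2) by simp
  then show ?thesis using U d ne odd edge by blast
qed

subsection \<open>Small Ramsey graphs\<close>

definition nbrs :: "'a set \<Rightarrow> 'a \<Rightarrow> 'a set" where
  "nbrs V v = {u\<in>V. E v u}"

lemma nbrs_subset: "nbrs V v \<subseteq> V" by (auto simp: nbrs_def)

lemma finite_nbrs: "finite V \<Longrightarrow> finite (nbrs V v)" by (simp add: nbrs_def)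

lemma sum_card_nbrs_even:
  assumes "finite V" shows "even (\<Sum>v\<in>V. card (nbrs V v))"
  using assms
proof (induction V rule: finite_induct)
  case empty then show ?case by simp
next
  case (insert a V)
  have 1: "card (nbrs (insert a V) v) = card (nbrs V v) + (if E a v then 1 else 0)" if "v \<in> V" for v
  proof (cases "E a v")
    case True
    then have "nbrs (insert a V) v = insert a (nbrs V v)" using sym by (auto simp: nbrs_def)
    then show ?thesis using True insert by (simp add: nbrs_def)
  next
    case False
    then have "nbrs (insert a V) v = nbrs V v" using sym by (auto simp: nbrs_def)
    then show ?thesis using False by simp
  qed
  have 2: "nbrs (insert a V) a = nbrs V a" using irrefl by (auto simp: nbrs_def)
  have "(\<Sum>v\<in>insert a V. card (nbrs (insert a V) v)) = card (nbrs V a) + (\<Sum>v\<in>V. card (nbrs V v) + (if E a v then 1 else 0))"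
    using insert by (simp add: 1 2)
  also have "\<dots> = 2 * card (nbrs V a) + (\<Sum>v\<in>V. card (nbrs V v))"
    using insert(1) by (simp only: sum.distrib sum_bool_card) (simp add: nbrs_def)
  finally show ?case using insert.IH by simp
qed

lemma stable_insert: "stable S \<Longrightarrow> (\<And>u. u \<in> S \<Longrightarrow> \<not> E v u) \<Longrightarrow> stable (insert v S)"
  unfolding stable_def using sym irrefl by (metis insert_iff)

lemma stable_nbrs: "triangle_free V \<Longrightarrow> v \<in> V \<Longrightarrow> stable (nbrs V v)"
  unfolding stable_def nbrs_def using tfreeD by blast

lemma stable_extend:
  assumes "finite V" "v \<in> V" "T \<subseteq> V - insert v (nbrs V v)" "stable T"
  shows "\<exists>S\<subseteq>V. stable S \<and> card S = Suc (card T)"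
proof (intro exI conjI)
  show "insert v T \<subseteq> V" using assms by auto
  show "stable (insert v T)" using assms by (intro stable_insert) (auto simp: nbrs_def)
  have "v \<notin> T" "finite T" using assms finite_subset by (blast, blast)
  then show "card (insert v T) = Suc (card T)" by simp
qed

lemma card_non_nbrs:
  assumes "finite V" "v \<in> V" shows "card (V - insert v (nbrs V v)) = card V - 1 - card (nbrs V v)"
proof -
  have "v \<notin> nbrs V v" using irrefl by (simp add: nbrs_def)
  then have "card (insert v (nbrs V v)) = Suc (card (nbrs V v))" using assms by (simp add: finite_nbrs)
  moreover have "insert v (nbrs V v) \<subseteq> V" using assms by (auto simp: nbrs_def)
  ultimately show ?thesis using assms by (simp add: card_Diff_subset finite_nbrs)
qed

lemma stable_subset_card:
  assumes "stable S" "S \<subseteq> V" "k \<le> card S" shows "\<exists>T\<subseteq>V. stable T \<and> card T = k"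
proof -
  obtain T where "T \<subseteq> S" "card T = k" using assms(3) by (meson obtain_subset_with_card_n)
  then show ?thesis using stable_mono[OF assms(1)] assms(2) by (intro exI[of _ T]) auto
qed

lemma stable_pair:
  assumes "finite V" "triangle_free V" "3 \<le> card V" shows "\<exists>S\<subseteq>V. stable S \<and> card S = 2"
proof -
  obtain T where "T \<subseteq> V" "card T = 3" using assms(3) by (meson obtain_subset_with_card_n)
  then obtain x y z where x: "x \<in> V" "y \<in> V" "z \<in> V" "x \<noteq> y" "x \<noteq> z" "y \<noteq> z"
    by (auto simp: card_3_iff)
  then obtain p q where "p \<in> V" "q \<in> V" "p \<noteq> q" "\<not> E p q"
    using tfreeD[OF assms(2), of x y z] by metis
  then have "{p, q} \<subseteq> V" "stable {p, q}" "card {p, q} = 2"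
    using sym irrefl by (auto simp: stable_def)
  then show ?thesis by blast
qed

lemma ramsey_3_3:
  assumes "finite V" "triangle_free V" "6 \<le> card V" shows "\<exists>S\<subseteq>V. stable S \<and> card S = 3"
proof -
  obtain v where v: "v \<in> V" using assms(3) by fastforce
  show ?thesis
  proof (cases "3 \<le> card (nbrs V v)")
    case True
    then show ?thesis using stable_subset_card[OF stable_nbrs[OF assms(2) v] nbrs_subset] by blast
  next
    case False
    then have "3 \<le> card (V - insert v (nbrs V v))" using card_non_nbrs[OF assms(1) v] assms(3) by simp
    then obtain T where T: "T \<subseteq> V - insert v (nbrs V v)" "stable T" "card T = 2"
      using stable_pair[of "V - insert v (nbrs V v)"] assms triangle_free_mono by (metis Diff_subset finite_Diff)
    then show ?thesis using stable_extend[OF assms(1) v T(1,2)] by simp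
  qed
qed

text \<open>On exactly nine vertices, a degree of at least 4 gives a stable neighbourhood, and a
  degree of at most 2 leaves six non-neighbours for \<open>ramsey_3_3\<close>. A cubic graph on nine
  vertices would have odd degree sum.\<close>

lemma ramsey_3_4:
  assumes "finite V" "triangle_free V" "9 \<le> card V" shows "\<exists>S\<subseteq>V. stable S \<and> card S = 4"
proof (rule ccontr)
  assume no: "\<not> ?thesis"
  obtain W where W: "W \<subseteq> V" "card W = 9" using assms(3) by (meson obtain_subset_with_card_n)
  have fW: "finite W" "triangle_free W" using W assms finite_subset triangle_free_mono by (blast, blast)
  have "card (nbrs W v) = 3" if v: "v \<in> W" for v
  proof (rule ccontr)
    assume "card (nbrs W v) \<noteq> 3"
    then consider "4 \<le> card (nbrs W v)" | "card (nbrs W v) \<le> 2" by linarith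
    then show False
    proof cases
      case 1
      then show ?thesis
        using stable_subset_card[OF stable_nbrs[OF fW(2) v] subset_trans[OF nbrs_subset W(1)]] no by blast
    next
      case 2
      then have "6 \<le> card (W - insert v (nbrs W v))" using card_non_nbrs[OF fW(1) v] W by simp
      then obtain T where T: "T \<subseteq> W - insert v (nbrs W v)" "stable T" "card T = 3"
        using ramsey_3_3[of "W - insert v (nbrs W v)"] fW triangle_free_mono by (metis Diff_subset finite_Diff)
      then have "\<exists>S\<subseteq>W. stable S \<and> card S = 4" using stable_extend[OF fW(1) v T(1,2)] by simp
      then show ?thesis using no W(1) by (meson order_trans)
    qed
  qed
  then have "(\<Sum>v\<in>W. card (nbrs W v)) = 27" using W by simp
  then show False using sum_card_nbrs_even[OF fW(1)] by simp
qed

section \<open>Pentagons: the Ramsey graph for (3,3) on five vertices\<close>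

definition pent :: "'a \<Rightarrow> 'a \<Rightarrow> 'a \<Rightarrow> 'a \<Rightarrow> 'a \<Rightarrow> bool" where
  "pent x y z w u \<longleftrightarrow> distinct [x, y, z, w, u] \<and> E x y \<and> E y z \<and> E z w \<and> E w u \<and> E u x
     \<and> \<not> E x z \<and> \<not> E x w \<and> \<not> E y w \<and> \<not> E y u \<and> \<not> E z u"

definition pentagon :: "'a set \<Rightarrow> bool" where
  "pentagon K \<longleftrightarrow> (\<exists>x y z w u. K = {x, y, z, w, u} \<and> pent x y z w u)"

lemma pent_rot: "pent x y z w u \<Longrightarrow> pent y z w u x"
  unfolding pent_def using sym by auto

lemma pentagonI: "pent x y z w u \<Longrightarrow> K = {x, y, z, w, u} \<Longrightarrow> pentagon K"
  unfolding pentagon_def by blast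

lemma pentagonE:
  assumes "pentagon K" obtains x y z w u where "K = {x, y, z, w, u}" "pent x y z w u"
  using assms unfolding pentagon_def by blast

lemma card_pentagon: "pentagon K \<Longrightarrow> card K = 5"
  by (auto simp: pentagon_def pent_def)

lemma pentagon_at:
  assumes "pentagon K" "v \<in> K"
  shows "\<exists>y z w u. K = {v, y, z, w, u} \<and> pent v y z w u"
proof -
  obtain a b c d e where K: "K = {a,b,c,d,e}" and p: "pent a b c d e"
    using assms(1) by (rule pentagonE)
  note p2 = pent_rot[OF p] note p3 = pent_rot[OF p2] note p4 = pent_rot[OF p3] note p5 = pent_rot[OF p4]
  from assms(2) K consider "v = a" | "v = b" | "v = c" | "v = d" | "v = e" by blast
  then show ?thesis
  proof cases
    case 1 then show ?thesis using p K by blast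
  next
    case 2 have "K = {b,c,d,e,a}" using K by blast then show ?thesis using 2 p2 by blast
  next
    case 3 have "K = {c,d,e,a,b}" using K by blast then show ?thesis using 3 p3 by blast
  next
    case 4 have "K = {d,e,a,b,c}" using K by blast then show ?thesis using 4 p4 by blast
  next
    case 5 have "K = {e,a,b,c,d}" using K by blast then show ?thesis using 5 p5 by blast
  qed
qed

lemma pentagon_of_ramsey:
  assumes "card K = 5" "triangle_free K" and no: "\<not> (\<exists>S\<subseteq>K. stable S \<and> card S = 3)"
  shows "pentagon K"
proof -
  have fin: "finite K" using assms(1) card.infinite by fastforce
  have tri: "\<not> (E p q \<and> E p r \<and> E q r)" "E p q \<or> E p r \<or> E q r"
    if "p \<in> K" "q \<in> K" "r \<in> K" "p \<noteq> q" "p \<noteq> r" "q \<noteq> r" for p q r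
  proof -
    show "\<not> (E p q \<and> E p r \<and> E q r)" using tfreeD[OF assms(2)] that by blast
    show "E p q \<or> E p r \<or> E q r"
    proof (rule ccontr)
      assume "\<not> ?thesis"
      then have "stable {p,q,r}" using sym irrefl by (auto simp: stable_def)
      moreover have "card {p,q,r} = 3" "{p,q,r} \<subseteq> K" using that by auto
      ultimately show False using no by blast
    qed
  qed
  obtain a K1 where a: "K = insert a K1" "a \<notin> K1" "card K1 = 4" "finite K1"
  proof -
    obtain a where "a \<in> K" using assms(1) by fastforce
    then show thesis using that[of a "K - {a}"] assms(1) fin by auto
  qed
  obtain b c d e where K1: "K1 = {b,c,d,e}" "distinct [b,c,d,e]"
    using a(3) by (auto simp: card_Suc_eq numeral_eq_Suc)
  have dist: "distinct [a,b,c,d,e]" and K: "K = {a,b,c,d,e}" using a K1 by auto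
  have t': "\<not> (E a b \<and> E a c \<and> E b c)" "E a b \<or> E a c \<or> E b c"
    "\<not> (E a b \<and> E a d \<and> E b d)" "E a b \<or> E a d \<or> E b d"
    "\<not> (E a b \<and> E a e \<and> E b e)" "E a b \<or> E a e \<or> E b e"
    "\<not> (E a c \<and> E a d \<and> E c d)" "E a c \<or> E a d \<or> E c d"
    "\<not> (E a c \<and> E a e \<and> E c e)" "E a c \<or> E a e \<or> E c e"
    "\<not> (E a d \<and> E a e \<and> E d e)" "E a d \<or> E a e \<or> E d e"
    "\<not> (E b c \<and> E b d \<and> E c d)" "E b c \<or> E b d \<or> E c d"
    "\<not> (E b c \<and> E b e \<and> E c e)" "E b c \<or> E b e \<or> E c e"
    "\<not> (E b d \<and> E b e \<and> E d e)" "E b d \<or> E b e \<or> E d e"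
    "\<not> (E c d \<and> E c e \<and> E d e)" "E c d \<or> E c e \<or> E d e"
    by (rule tri; use dist in \<open>simp add: K\<close>)+
  have s: "E b a = E a b" "E c a = E a c" "E d a = E a d" "E e a = E a e" "E c b = E b c"
    "E d b = E b d" "E e b = E b e" "E d c = E c d" "E e c = E c e" "E e d = E d e"
    using sym by blast+
  \<comment> \<open>The 4!/2 = 12 cyclic orders of five labelled vertices, up to rotation and
    reflection.\<close>
  have "pent a b c d e \<or> pent a b c e d \<or> pent a b d c e \<or> pent a b d e c \<or> pent a b e c d \<or> pent a b e d c
     \<or> pent a c b d e \<or> pent a c b e d \<or> pent a c d b e \<or> pent a c e b d \<or> pent a d b c e \<or> pent a d c b e"
  proof -
    have D: "distinct [a,b,c,d,e] \<Longrightarrow> ?thesis"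
      unfolding pent_def using t' s by simp argo
    show ?thesis by (rule D[OF dist])
  qed
  then show ?thesis
    unfolding K by (elim disjE) (erule pentagonI, blast)+
qed

lemma ccol_edge: "E u v \<Longrightarrow> ccol {u, v} 1"
  using sym by (intro ccol_clique) auto

text \<open>A pentagon minus a vertex has a perfect matching, so pairing \<open>t\<close> with that
  vertex uses no more than the three colours the pentagon needs anyway.\<close>

lemma ccol_pentagon_insert:
  assumes "pentagon K" "v \<in> K" "E t v" shows "ccol (insert t K) 3"
proof -
  obtain y z w u where K: "K = {v, y, z, w, u}" and p: "pent v y z w u"
    using pentagon_at[OF assms(1,2)] by blast
  have e: "E y z" "E w u" using p by (auto simp: pent_def)
  have "ccol {t, v} 1" "ccol {y, z} 1" "ccol {w, u} 1"
    using e assms(3) by (auto dest: ccol_edge)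
  from ccol_Un[OF ccol_Un[OF this(1,2)] this(3)] show ?thesis
    by (rule ccol_mono) (auto simp: K)
qed

lemma ccol_pentagon: "pentagon K \<Longrightarrow> ccol K 3"
  using pentagonE[of K] ccol_pentagon_insert[of K] ccol_mono
  by (metis insertI1 order_refl pent_def subset_insertI sym)

text \<open>The complement of three consecutive vertices is an adjacent pair. If \<open>t\<close> is
  not adjacent to three consecutive vertices, its non-neighbours are contained in no adjacent pair,
  hence include a nonadjacent one.\<close>

lemma pentagon_stable_or_cover:
  assumes "pentagon K"
  shows "(\<exists>S\<subseteq>K. stable S \<and> card S = 2 \<and> (\<forall>s\<in>S. \<not> E t s)) \<or>
    (\<exists>x y z w u. K = {x, y, z, w, u} \<and> pent x y z w u \<and> E t z \<and> E t w \<and> E t u)"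
proof (rule disjCI)
  assume no: "\<not> (\<exists>x y z w u. K = {x, y, z, w, u} \<and> pent x y z w u \<and> E t z \<and> E t w \<and> E t u)"
  obtain a b c d e where K: "K = {a,b,c,d,e}" and p: "pent a b c d e"
    using assms by (rule pentagonE)
  note p2 = pent_rot[OF p] note p3 = pent_rot[OF p2] note p4 = pent_rot[OF p3] note p5 = pent_rot[OF p4]
  have "\<not> (E t c \<and> E t d \<and> E t e)" using no p K by blast
  moreover have "K = {b,c,d,e,a}" using K by blast
  then have "\<not> (E t d \<and> E t e \<and> E t a)" using no p2 by blast
  moreover have "K = {c,d,e,a,b}" using K by blast
  then have "\<not> (E t e \<and> E t a \<and> E t b)" using no p3 by blast
  moreover have "K = {d,e,a,b,c}" using K by blast
  then have "\<not> (E t a \<and> E t b \<and> E t c)" using no p4 by blast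
  moreover have "K = {e,a,b,c,d}" using K by blast
  then have "\<not> (E t b \<and> E t c \<and> E t d)" using no p5 by blast
  ultimately consider "\<not> E t a \<and> \<not> E t c" | "\<not> E t a \<and> \<not> E t d" | "\<not> E t b \<and> \<not> E t d"
    | "\<not> E t b \<and> \<not> E t e" | "\<not> E t c \<and> \<not> E t e" by argo
  then obtain q r where "q \<in> K" "r \<in> K" "q \<noteq> r" "\<not> E q r" "\<not> E t q" "\<not> E t r"
    using p unfolding pent_def K by cases auto
  then have "{q, r} \<subseteq> K" "stable {q, r}" "card {q, r} = 2" "\<forall>s\<in>{q, r}. \<not> E t s"
    using sym irrefl by (auto simp: stable_def)
  then show "\<exists>S\<subseteq>K. stable S \<and> card S = 2 \<and> (\<forall>s\<in>S. \<not> E t s)" by blast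
qed

text \<open>The complement of the graph \<open>Q\<close>.  Only the 26 edges are required, because their presence is what a
  homomorphism into \<open>Q\<close> needs.\<close>

definition circ13 :: "'a set \<Rightarrow> bool" where
  "circ13 W \<longleftrightarrow> (\<exists>vs. length vs = 13 \<and> distinct vs \<and> set vs = W \<and>
     (\<forall>i<13. E (vs ! i) (vs ! ((i + 1) mod 13)) \<and> E (vs ! i) (vs ! ((i + 5) mod 13))))"

section \<open>Uniqueness of the Ramsey graph for (3,5) on 13 vertices\<close>

lemma circ13I:
  assumes "distinct [v, a, x0, x1, e, c, x3, x4, b, w, f, x2, d]"
    and "E v a" "E v b" "E v c" "E v d" "E w a" "E w b" "E w e" "E w f"
    and "E c e" "E c f" "E d e" "E f x0" "E f x2" "E e x1" "E d x2" "E d x4" "E c x3"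
    and "E a x0" "E a x3" "E b x1" "E b x4"
    and "E x0 x1" "E x1 x2" "E x2 x3" "E x3 x4" "E x4 x0"
  shows "circ13 {v, a, x0, x1, e, c, x3, x4, b, w, f, x2, d}"
proof -
  \<comment> \<open>The list is the order around the circulant: each of the 26 assumed edges joins
    positions at cyclic distance 1 or 5, and each such pair occurs once.\<close>
  have "E ([v, a, x0, x1, e, c, x3, x4, b, w, f, x2, d] ! i) ([v, a, x0, x1, e, c, x3, x4, b, w, f, x2, d] ! ((i + 1) mod 13)) \<and>
      E ([v, a, x0, x1, e, c, x3, x4, b, w, f, x2, d] ! i) ([v, a, x0, x1, e, c, x3, x4, b, w, f, x2, d] ! ((i + 5) mod 13))" if "i < 13" for i :: nat
  proof -
    from that have "i \<in> {0,1,2,3,4,5,6,7,8,9,10,11,12}" by (simp, presburger)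
    then show ?thesis using assms(2-) sym by auto
  qed
  then show ?thesis unfolding circ13_def using assms(1)
    by (intro exI[of _ "[v, a, x0, x1, e, c, x3, x4, b, w, f, x2, d]"]) simp
qed

text \<open>At most three vertices satisfy \<open>P\<close> or \<open>Q\<close>, and the others must
  be pairwise adjacent, so exactly two consecutive vertices are left over. The three others are
  consecutive as well; since the two in \<open>P\<close> are nonadjacent, they are the ends and
  \<open>Q\<close> marks the middle. A rotation moves them to \<open>y0\<close>, \<open>y1\<close>,
  \<open>y2\<close>.\<close>

lemma pent_pair:
  assumes "pent x0 x1 x2 x3 x4"
    and "\<And>x y. x \<in> {x0,x1,x2,x3,x4} \<Longrightarrow> y \<in> {x0,x1,x2,x3,x4} \<Longrightarrow> P x \<Longrightarrow> P y \<Longrightarrow> \<not> E x y"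
    and "\<And>x y. x \<in> {x0,x1,x2,x3,x4} \<Longrightarrow> y \<in> {x0,x1,x2,x3,x4} \<Longrightarrow> x \<noteq> y \<Longrightarrow> \<not> E x y \<Longrightarrow> P x \<or> P y \<or> Q x \<or> Q y"
    and "of_bool (P x0) + of_bool (P x1) + of_bool (P x2) + of_bool (P x3) + of_bool (P x4) = (2::nat)"
    and "of_bool (Q x0) + of_bool (Q x1) + of_bool (Q x2) + of_bool (Q x3) + of_bool (Q x4) = (1::nat)"
  obtains y0 y1 y2 y3 y4 where "pent y0 y1 y2 y3 y4" "{y0,y1,y2,y3,y4} = {x0,x1,x2,x3,x4}"
    "P y0" "P y2" "Q y1" "\<not> P y1" "\<not> P y3" "\<not> P y4" "\<not> Q y0" "\<not> Q y2" "\<not> Q y3" "\<not> Q y4"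
proof -
  note p = assms(1) note p2 = pent_rot[OF p] note p3 = pent_rot[OF p2] note p4 = pent_rot[OF p3] note p5 = pent_rot[OF p4]
  have s: "{x1,x2,x3,x4,x0} = {x0,x1,x2,x3,x4}" "{x2,x3,x4,x0,x1} = {x0,x1,x2,x3,x4}"
    "{x3,x4,x0,x1,x2} = {x0,x1,x2,x3,x4}" "{x4,x0,x1,x2,x3} = {x0,x1,x2,x3,x4}" by blast+
  have nP: "\<not> (P x0 \<and> P x1)" "\<not> (P x1 \<and> P x2)" "\<not> (P x2 \<and> P x3)" "\<not> (P x3 \<and> P x4)" "\<not> (P x4 \<and> P x0)"
    using assms(2)[of x0 x1] assms(2)[of x1 x2] assms(2)[of x2 x3] assms(2)[of x3 x4] assms(2)[of x4 x0] p
    by (auto simp: pent_def)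
  have cov: "P x0 \<or> P x2 \<or> Q x0 \<or> Q x2" "P x1 \<or> P x3 \<or> Q x1 \<or> Q x3" "P x2 \<or> P x4 \<or> Q x2 \<or> Q x4"
    "P x0 \<or> P x3 \<or> Q x0 \<or> Q x3" "P x1 \<or> P x4 \<or> Q x1 \<or> Q x4"
    using assms(3)[of x0 x2] assms(3)[of x1 x3] assms(3)[of x2 x4] assms(3)[of x0 x3] assms(3)[of x1 x4] p
    by (auto simp: pent_def)
  consider "P x0" "P x2" "Q x1" "\<not> P x1" "\<not> P x3" "\<not> P x4" "\<not> Q x0" "\<not> Q x2" "\<not> Q x3" "\<not> Q x4"
    | "P x1" "P x3" "Q x2" "\<not> P x2" "\<not> P x4" "\<not> P x0" "\<not> Q x1" "\<not> Q x3" "\<not> Q x4" "\<not> Q x0"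
    | "P x2" "P x4" "Q x3" "\<not> P x3" "\<not> P x0" "\<not> P x1" "\<not> Q x2" "\<not> Q x4" "\<not> Q x0" "\<not> Q x1"
    | "P x3" "P x0" "Q x4" "\<not> P x4" "\<not> P x1" "\<not> P x2" "\<not> Q x3" "\<not> Q x0" "\<not> Q x1" "\<not> Q x2"
    | "P x4" "P x1" "Q x0" "\<not> P x0" "\<not> P x2" "\<not> P x3" "\<not> Q x4" "\<not> Q x1" "\<not> Q x2" "\<not> Q x3"
    using nP cov assms(4,5) by (simp only: of_bool_def split: if_splits) (simp_all, argo?)
  then show thesis
  proof cases
    case 1 then show thesis using that[OF p] by blast
  next
    case 2 then show thesis using that[OF p2 s(1)] by blast
  next
    case 3 then show thesis using that[OF p3 s(2)] by blast
  next
    case 4 then show thesis using that[OF p4 s(3)] by blast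
  next
    case 5 then show thesis using that[OF p5 s(4)] by blast
  qed
qed

lemma card_nbrs_list:
  "distinct L \<Longrightarrow> card (nbrs (set L) u) = sum_list (map (\<lambda>q. of_bool (E u q)) L)"
proof (induction L)
  case Nil then show ?case by (simp add: nbrs_def)
next
  case (Cons p L)
  have "nbrs (set (p # L)) u = (if E u p then insert p (nbrs (set L) u) else nbrs (set L) u)"
    by (auto simp: nbrs_def)
  moreover have "p \<notin> nbrs (set L) u" "finite (nbrs (set L) u)" using Cons.prems by (auto simp: nbrs_def)
  ultimately show ?case using Cons by simp
qed

lemma stable_insert_iff: "stable (insert p S) \<longleftrightarrow> stable S \<and> (\<forall>q\<in>S. \<not> E p q)"
  unfolding stable_def using sym irrefl by blast

lemma stable_empty: "stable {}"
  by (simp add: stable_def)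

text \<open>Here \<open>v\<close> and \<open>w\<close> have the common neighbours \<open>a\<close>, \<open>b\<close>; the further neighbours are \<open>c\<close>, \<open>d\<close> of \<open>v\<close>
  and \<open>e\<close>, \<open>f\<close> of \<open>w\<close>.  Counting degrees shows that exactly three of the four pairs between \<open>{c, d}\<close> and
  \<open>{e, f}\<close> are edges, and then the graph is determined up to symmetry.\<close>

lemma circ13_core:
  assumes dist: "distinct [v,w,a,b,c,d,e,f,x0,x1,x2,x3,x4]"
    and V: "V = set [v,w,a,b,c,d,e,f,x0,x1,x2,x3,x4]"
    and tf: "triangle_free V" and no5: "\<not> (\<exists>S\<subseteq>V. stable S \<and> card S = 5)"
    and deg: "\<And>u. u \<in> V \<Longrightarrow> card (nbrs V u) = 4"
    and v: "E v a" "E v b" "E v c" "E v d" "\<not> E v w" "\<not> E v e" "\<not> E v f"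
    and w: "E w a" "E w b" "E w e" "E w f" "\<not> E w c" "\<not> E w d"
    and X: "\<And>x. x \<in> {x0,x1,x2,x3,x4} \<Longrightarrow> \<not> E x v \<and> \<not> E x w"
    and p: "pent x0 x1 x2 x3 x4"
    and cd: "E c e" "E c f" "E d e" "\<not> E d f"
  shows "circ13 V"
proof -
  let ?X = "{x0,x1,x2,x3,x4}"
  have com: "E p q = E q p" for p q using sym by blast
  have tri: "E p q \<Longrightarrow> E q r \<Longrightarrow> \<not> E p r" if "p \<in> V" "q \<in> V" "r \<in> V" for p q r
    using tfreeD[OF tf that] .
  have mem: "v \<in> V" "w \<in> V" "a \<in> V" "b \<in> V" "c \<in> V" "d \<in> V" "e \<in> V" "f \<in> V"
    "x0 \<in> V" "x1 \<in> V" "x2 \<in> V" "x3 \<in> V" "x4 \<in> V" and XV: "?X \<subseteq> V" by (auto simp: V)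
  have n1: "\<not> E p q" if "p \<in> {a,b,c,d}" "q \<in> {a,b,c,d}" for p q
    using that tri[of p v q] v mem com by blast
  have n2: "\<not> E p q" if "p \<in> {a,b,e,f}" "q \<in> {a,b,e,f}" for p q
    using that tri[of p w q] w mem com by blast
  \<comment> \<open>Otherwise \<open>v\<close>, \<open>e\<close>, \<open>f\<close>,
    \<open>x\<close>, \<open>y\<close> or \<open>w\<close>, \<open>c\<close>, \<open>d\<close>,
    \<open>x\<close>, \<open>y\<close> would be a stable set of size five.\<close>
  have hit: "E p x \<or> E p y \<or> E q x \<or> E q y"
    if "(p = e \<and> q = f) \<or> (p = c \<and> q = d)" "x \<in> ?X" "y \<in> ?X" "x \<noteq> y" "\<not> E x y" for p q x y
  proof (rule ccontr)
    assume no: "\<not> ?thesis"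
    define t where "t = (if p = e then v else w)"
    have "\<not> E t p" "\<not> E t q" "t \<in> {v, w}" "\<not> E p q"
      using that(1) v w dist n1[of c d] n2[of e f] by (auto simp: t_def)
    then have "stable {t, p, q, x, y}"
      using no X[OF that(2)] X[OF that(3)] that(5) com by (auto simp: stable_insert_iff stable_empty)
    moreover have "card {t, p, q, x, y} = 5"
    proof -
      have "distinct [t, p, q, x, y]" using that dist by (auto simp: t_def)
      then show ?thesis by simp
    qed
    moreover have "{t, p, q, x, y} \<subseteq> V" using that mem by (auto simp: t_def)
    ultimately show False using no5 by blast
  qed
  have nbX: "\<not> E x y" if "x \<in> ?X" "y \<in> ?X" "E q x" "E q y" "q \<in> V" for x y q
    using tri[of x q y] that XV com by blast
  have degs: "sum_list (map (\<lambda>q. of_bool (E u q)) [v,w,a,b,c,d,e,f,x0,x1,x2,x3,x4]) = (4::nat)" if "u \<in> V" for u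
    using deg[OF that] card_nbrs_list[OF dist, of u] by (simp only: V)
  \<comment> \<open>Outside the pentagon \<open>f\<close> has the neighbours \<open>w\<close> and
    \<open>c\<close>, and \<open>e\<close> has \<open>w\<close>, \<open>c\<close> and
    \<open>d\<close>; degree four leaves two and one inside.\<close>
  have sf: "of_bool (E f x0) + of_bool (E f x1) + of_bool (E f x2) + of_bool (E f x3) + of_bool (E f x4) = (2::nat)"
    using degs[OF mem(8)] v(7) w(4) cd(2,4) n2[of f] com[of f v] com[of f w] com[of f c] com[of f d] irrefl by simp
  have se: "of_bool (E e x0) + of_bool (E e x1) + of_bool (E e x2) + of_bool (E e x3) + of_bool (E e x4) = (1::nat)"
    using degs[OF mem(7)] v(6) w(3) cd(1,3) n2[of e] com[of e v] com[of e w] com[of e c] com[of e d] irrefl by simp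
  obtain y0 y1 y2 y3 y4 where q: "pent y0 y1 y2 y3 y4" and qX: "{y0,y1,y2,y3,y4} = ?X" and
    fe: "E f y0" "E f y2" "E e y1" "\<not> E f y1" "\<not> E f y3" "\<not> E f y4" "\<not> E e y0" "\<not> E e y2" "\<not> E e y3" "\<not> E e y4"
    by (rule pent_pair[OF p _ _ sf se]) (erule (3) nbX[OF _ _ _ _ mem(8)], use hit[of e f] in blast, rule that)
  have ymem: "y0 \<in> V" "y1 \<in> V" "y2 \<in> V" "y3 \<in> V" "y4 \<in> V" using qX XV by blast+
  have L: "distinct [v,w,a,b,c,d,e,f,y0,y1,y2,y3,y4]"
  proof -
    have "distinct [y0,y1,y2,y3,y4]" using q by (simp add: pent_def)
    moreover have "distinct [v,w,a,b,c,d,e,f]" "{v,w,a,b,c,d,e,f} \<inter> {y0,y1,y2,y3,y4} = {}"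
      using dist unfolding qX by auto
    ultimately show ?thesis by auto
  qed
  have Vy: "V = set [v,w,a,b,c,d,e,f,y0,y1,y2,y3,y4]" using qX unfolding V by auto
  have yX: "\<not> E y v \<and> \<not> E y w" if "y \<in> {y0,y1,y2,y3,y4}" for y using X that qX by blast
  have degy: "sum_list (map (\<lambda>q. of_bool (E u q)) [v,w,a,b,c,d,e,f,y0,y1,y2,y3,y4]) = (4::nat)" if "u \<in> V" for u
    using deg[OF that] card_nbrs_list[OF L, of u] by (simp only: Vy)
  have pe: "E y0 y1" "E y1 y2" "E y2 y3" "E y3 y4" "E y4 y0"
    "\<not> E y0 y2" "\<not> E y0 y3" "\<not> E y1 y3" "\<not> E y1 y4" "\<not> E y2 y4" using q by (auto simp: pent_def)
  have sd: "of_bool (E d y0) + of_bool (E d y1) + of_bool (E d y2) + of_bool (E d y3) + of_bool (E d y4) = (2::nat)"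
    using degy[OF mem(6)] v(4) w(6) cd(3,4) n1[of d] com[of d v] com[of d w] irrefl by simp
  have sc: "of_bool (E c y0) + of_bool (E c y1) + of_bool (E c y2) + of_bool (E c y3) + of_bool (E c y4) = (1::nat)"
    using degy[OF mem(5)] v(3) w(5) cd(1,2) n1[of c] com[of c v] com[of c w] irrefl by simp
  have sa: "of_bool (E a y0) + of_bool (E a y1) + of_bool (E a y2) + of_bool (E a y3) + of_bool (E a y4) = (2::nat)"
    using degy[OF mem(3)] v(1) w(1) n1[of a] n2[of a] com[of a v] com[of a w] irrefl by simp
  have sb: "of_bool (E b y0) + of_bool (E b y1) + of_bool (E b y2) + of_bool (E b y3) + of_bool (E b y4) = (2::nat)"
    using degy[OF mem(4)] v(2) w(2) n1[of b] n2[of b] com[of b v] com[of b w] irrefl by simp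
  have cf: "\<not> E c y0" "\<not> E c y2" "\<not> E c y1" "\<not> E d y1"
    using tri[of c f y0] tri[of c f y2] tri[of c e y1] tri[of d e y1] cd fe mem ymem by blast+
  have nbY: "\<not> (E q x \<and> E q y)" if "E x y" "x \<in> V" "y \<in> V" "q \<in> V" for q x y
    using tri[of x q y] that com by blast
  have nd: "\<not> (E q y0 \<and> E q y1)" "\<not> (E q y1 \<and> E q y2)" "\<not> (E q y2 \<and> E q y3)" "\<not> (E q y3 \<and> E q y4)" "\<not> (E q y4 \<and> E q y0)"
    if "q \<in> V" for q
    using nbY[OF pe(1) ymem(1,2) that] nbY[OF pe(2) ymem(2,3) that] nbY[OF pe(3) ymem(3,4) that]
      nbY[OF pe(4) ymem(4,5) that] nbY[OF pe(5) ymem(5,1) that] by simp_all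
  have hy: "E c x \<or> E c y \<or> E d x \<or> E d y" if "x \<in> {y0,y1,y2,y3,y4}" "y \<in> {y0,y1,y2,y3,y4}" "x \<noteq> y" "\<not> E x y" for x y
    using hit[of c d x y] that unfolding qX by blast
  have hits: "E c y0 \<or> E c y2 \<or> E d y0 \<or> E d y2" "E c y1 \<or> E c y3 \<or> E d y1 \<or> E d y3" "E c y2 \<or> E c y4 \<or> E d y2 \<or> E d y4"
    "E c y0 \<or> E c y3 \<or> E d y0 \<or> E d y3" "E c y1 \<or> E c y4 \<or> E d y1 \<or> E d y4"
    using hy[of y0 y2] hy[of y1 y3] hy[of y2 y4] hy[of y0 y3] hy[of y1 y4] pe L by auto
  \<comment> \<open>Triangle-freeness keeps \<open>c\<close> away from the pentagon neighbours
    \<open>y0\<close>, \<open>y1\<close>, \<open>y2\<close> of \<open>e\<close> and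
    \<open>f\<close>, so its single neighbour there is \<open>y3\<close> or \<open>y4\<close>. As in
    \<open>pent_pair\<close>, the two neighbours of \<open>d\<close> are then those surrounding
    it.\<close>
  have "(E d y2 \<and> E d y4 \<and> E c y3 \<and> \<not> E d y0 \<and> \<not> E d y3 \<and> \<not> E c y4) \<or>
        (E d y0 \<and> E d y3 \<and> E c y4 \<and> \<not> E d y2 \<and> \<not> E d y4 \<and> \<not> E c y3)"
    using sd sc cf hits nd[OF mem(6)] by (simp only: of_bool_def split: if_splits) (simp_all, argo?)
  then have dc: "(\<exists>y0 y1 y2 y3 y4. distinct [v,w,a,b,c,d,e,f,y0,y1,y2,y3,y4] \<and> V = set [v,w,a,b,c,d,e,f,y0,y1,y2,y3,y4] \<and>
     pent y0 y1 y2 y3 y4 \<and> E f y0 \<and> E f y2 \<and> E e y1 \<and> E d y2 \<and> E d y4 \<and> E c y3 \<and>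
     \<not> E f y1 \<and> \<not> E f y3 \<and> \<not> E f y4 \<and> \<not> E e y0 \<and> \<not> E e y2 \<and> \<not> E e y3 \<and> \<not> E e y4 \<and>
     \<not> E d y0 \<and> \<not> E d y1 \<and> \<not> E d y3 \<and> \<not> E c y0 \<and> \<not> E c y1 \<and> \<not> E c y2 \<and> \<not> E c y4)"
  proof
    assume h: "E d y2 \<and> E d y4 \<and> E c y3 \<and> \<not> E d y0 \<and> \<not> E d y3 \<and> \<not> E c y4"
    show ?thesis
      by (rule exI[of _ y0], rule exI[of _ y1], rule exI[of _ y2], rule exI[of _ y3], rule exI[of _ y4])
         (use h q fe L Vy cf in blast)
  next
    assume h: "E d y0 \<and> E d y3 \<and> E c y4 \<and> \<not> E d y2 \<and> \<not> E d y4 \<and> \<not> E c y3"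
    \<comment> \<open>The reflection fixing \<open>y1\<close> preserves what is known about
      \<open>e\<close> and \<open>f\<close> and turns this case into the first.\<close>
    have "pent y2 y1 y0 y4 y3" using q com by (auto simp: pent_def)
    moreover have "distinct [v,w,a,b,c,d,e,f,y2,y1,y0,y4,y3]" using L by auto
    moreover have "V = set [v,w,a,b,c,d,e,f,y2,y1,y0,y4,y3]" unfolding Vy by auto
    ultimately show ?thesis
      apply (intro exI)
      apply (rule conjI, assumption)+
      using h fe cf by blast
  qed
  then obtain z0 z1 z2 z3 z4 where Lz: "distinct [v,w,a,b,c,d,e,f,z0,z1,z2,z3,z4]"
    and Vz: "V = set [v,w,a,b,c,d,e,f,z0,z1,z2,z3,z4]" and r: "pent z0 z1 z2 z3 z4"
    and zs: "E f z0" "E f z2" "E e z1" "E d z2" "E d z4" "E c z3"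
     "\<not> E f z1" "\<not> E f z3" "\<not> E f z4" "\<not> E e z0" "\<not> E e z2" "\<not> E e z3" "\<not> E e z4"
     "\<not> E d z0" "\<not> E d z1" "\<not> E d z3" "\<not> E c z0" "\<not> E c z1" "\<not> E c z2" "\<not> E c z4"
    by (elim exE conjE) (rule that)
  have zmem: "z0 \<in> V" "z1 \<in> V" "z2 \<in> V" "z3 \<in> V" "z4 \<in> V" by (auto simp: Vz)
  have zX: "\<not> E z v \<and> \<not> E z w" if "z \<in> {z0,z1,z2,z3,z4}" for z
  proof -
    have "z \<in> ?X" using that Lz zmem unfolding V by auto
    then show ?thesis by (rule X)
  qed
  have degz: "sum_list (map (\<lambda>q. of_bool (E u q)) [v,w,a,b,c,d,e,f,z0,z1,z2,z3,z4]) = (4::nat)" if "u \<in> V" for u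
    using deg[OF that] card_nbrs_list[OF Lz, of u] by (simp only: Vz)
  have pz: "E z0 z1" "E z1 z2" "E z2 z3" "E z3 z4" "E z4 z0"
    "\<not> E z0 z2" "\<not> E z0 z3" "\<not> E z1 z3" "\<not> E z1 z4" "\<not> E z2 z4" using r by (auto simp: pent_def)
  have pz': "E z1 z0" "E z2 z1" "E z3 z2" "E z4 z3" "E z0 z4"
    "\<not> E z2 z0" "\<not> E z3 z0" "\<not> E z3 z1" "\<not> E z4 z1" "\<not> E z4 z2" using pz com by blast+
  have cols: "of_bool (E a z) + of_bool (E b z) + (of_bool (E c z) + of_bool (E d z) + of_bool (E e z) + of_bool (E f z)
      + of_bool (E z z0) + of_bool (E z z1) + of_bool (E z z2) + of_bool (E z z3) + of_bool (E z z4)) = (4::nat)"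
    if "z \<in> {z0,z1,z2,z3,z4}" for z
  proof -
    have "z \<in> V" using that zmem by blast
    from degz[OF this] zX[OF that] show ?thesis
      by (simp add: com[of z a] com[of z b] com[of z c] com[of z d] com[of z e] com[of z f])
  qed
  have col: "of_bool (E a z0) + of_bool (E b z0) = (1::nat)" "of_bool (E a z1) + of_bool (E b z1) = (1::nat)"
    "of_bool (E a z2) + of_bool (E b z2) = (0::nat)" "of_bool (E a z3) + of_bool (E b z3) = (1::nat)"
    "of_bool (E a z4) + of_bool (E b z4) = (1::nat)"
    using cols[of z0] cols[of z1] cols[of z2] cols[of z3] cols[of z4] zs pz pz' irrefl by simp_all
  have ndz: "\<not> (E q z0 \<and> E q z1)" "\<not> (E q z3 \<and> E q z4)" "\<not> (E q z4 \<and> E q z0)" if "q \<in> V" for q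
    using nbY[OF pz(1) zmem(1,2) that] nbY[OF pz(4) zmem(4,5) that] nbY[OF pz(5) zmem(5,1) that] by simp_all
  \<comment> \<open>Each of \<open>z0\<close>, \<open>z1\<close>, \<open>z3\<close>,
    \<open>z4\<close> has exactly one neighbour in \<open>{a, b}\<close>, and consecutive vertices
    of the path \<open>z1\<close>, \<open>z0\<close>, \<open>z4\<close>, \<open>z3\<close> choose
    differently. The two solutions are exchanged by swapping \<open>a\<close> and
    \<open>b\<close>.\<close>
  have "(E a z0 \<and> E a z3 \<and> E b z1 \<and> E b z4) \<or> (E b z0 \<and> E b z3 \<and> E a z1 \<and> E a z4)"
    using col ndz[OF mem(3)] ndz[OF mem(4)] by (simp only: of_bool_def split: if_splits) (simp_all, argo?)
  then show ?thesis
  proof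
    assume "E a z0 \<and> E a z3 \<and> E b z1 \<and> E b z4"
    then have "circ13 {v, a, z0, z1, e, c, z3, z4, b, w, f, z2, d}"
      using v w cd zs pz Lz by (intro circ13I) auto
    moreover have "V = {v, a, z0, z1, e, c, z3, z4, b, w, f, z2, d}" unfolding Vz by auto
    ultimately show ?thesis by simp
  next
    assume "E b z0 \<and> E b z3 \<and> E a z1 \<and> E a z4"
    then have "circ13 {v, b, z0, z1, e, c, z3, z4, a, w, f, z2, d}"
      using v w cd zs pz Lz by (intro circ13I) auto
    moreover have "V = {v, b, z0, z1, e, c, z3, z4, a, w, f, z2, d}" unfolding Vz by auto
    ultimately show ?thesis by simp
  qed
qed

text \<open>Each pentagon vertex has two neighbours in \<open>{a, b, c, d, e, f}\<close>, ten edges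
  in total. With \<open>N\<close> edges between \<open>{c, d}\<close> and \<open>{e, f}\<close>, the
  same edges number 2 + 2 + (12 - 2 N), so \<open>N = 3\<close>; swapping names makes
  \<open>d\<close>, \<open>f\<close> the missing pair.\<close>

lemma circ13_of_codegree_2:
  assumes dist: "distinct [v,w,a,b,c,d,e,f,x0,x1,x2,x3,x4]"
    and V: "V = set [v,w,a,b,c,d,e,f,x0,x1,x2,x3,x4]"
    and tf: "triangle_free V" and no5: "\<not> (\<exists>S\<subseteq>V. stable S \<and> card S = 5)"
    and deg: "\<And>u. u \<in> V \<Longrightarrow> card (nbrs V u) = 4"
    and v: "E v a" "E v b" "E v c" "E v d" "\<not> E v w" "\<not> E v e" "\<not> E v f"
    and w: "E w a" "E w b" "E w e" "E w f" "\<not> E w c" "\<not> E w d"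
    and X: "\<And>x. x \<in> {x0,x1,x2,x3,x4} \<Longrightarrow> \<not> E x v \<and> \<not> E x w"
    and p: "pent x0 x1 x2 x3 x4"
  shows "circ13 V"
proof -
  have com: "E p q = E q p" for p q using sym by blast
  have tri: "E p q \<Longrightarrow> E q r \<Longrightarrow> \<not> E p r" if "p \<in> V" "q \<in> V" "r \<in> V" for p q r
    using tfreeD[OF tf that] .
  have mem: "v \<in> V" "w \<in> V" "a \<in> V" "b \<in> V" "c \<in> V" "d \<in> V" "e \<in> V" "f \<in> V"
    "x0 \<in> V" "x1 \<in> V" "x2 \<in> V" "x3 \<in> V" "x4 \<in> V" by (auto simp: V)
  have n1: "\<not> E p q" if "p \<in> {a,b,c,d}" "q \<in> {a,b,c,d}" for p q
    using that tri[of p v q] v mem com by blast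
  have n2: "\<not> E p q" if "p \<in> {a,b,e,f}" "q \<in> {a,b,e,f}" for p q
    using that tri[of p w q] w mem com by blast
  define \<beta> where "\<beta> u = (\<Sum>x\<leftarrow>[x0,x1,x2,x3,x4]. of_bool (E u x) :: nat)" for u
  have degs: "of_bool (E u v) + of_bool (E u w) + of_bool (E u a) + of_bool (E u b) + of_bool (E u c)
      + of_bool (E u d) + of_bool (E u e) + of_bool (E u f) + \<beta> u = (4::nat)" if "u \<in> V" for u
    using deg[OF that] card_nbrs_list[OF dist, of u] by (simp add: V \<beta>_def)
  have vw': "E a v" "E b v" "E c v" "E d v" "\<not> E e v" "\<not> E f v" "E a w" "E b w" "E e w" "E f w" "\<not> E c w" "\<not> E d w"
    using v w com by blast+
  have row: "\<beta> a = 2" "\<beta> b = 2" "of_bool (E c e) + of_bool (E c f) + \<beta> c = 3" "of_bool (E d e) + of_bool (E d f) + \<beta> d = 3"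
    "of_bool (E c e) + of_bool (E d e) + \<beta> e = 3" "of_bool (E c f) + of_bool (E d f) + \<beta> f = 3"
    using degs[OF mem(3)] degs[OF mem(4)] degs[OF mem(5)] degs[OF mem(6)] degs[OF mem(7)] degs[OF mem(8)]
    by (simp_all add: vw' n1 n2 com[of e c] com[of e d] com[of f c] com[of f d])
  have col: "of_bool (E a x) + of_bool (E b x) + of_bool (E c x) + of_bool (E d x) + of_bool (E e x) + of_bool (E f x) = (2::nat)"
    if "x \<in> {x0,x1,x2,x3,x4}" for x
  proof -
    have "E x0 x1" "E x1 x2" "E x2 x3" "E x3 x4" "E x4 x0" "E x1 x0" "E x2 x1" "E x3 x2" "E x4 x3" "E x0 x4"
      "\<not> E x0 x2" "\<not> E x0 x3" "\<not> E x1 x3" "\<not> E x1 x4" "\<not> E x2 x4"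
      "\<not> E x2 x0" "\<not> E x3 x0" "\<not> E x3 x1" "\<not> E x4 x1" "\<not> E x4 x2"
      using p com unfolding pent_def by blast+
    then have "\<beta> x = 2" using that irrefl unfolding \<beta>_def by (elim insertE) simp_all
    moreover have "x \<in> V" using that mem by blast
    ultimately show ?thesis
      using degs[of x] X[OF that]
      by (simp add: com[of x a] com[of x b] com[of x c] com[of x d] com[of x e] com[of x f])
  qed
  have "of_bool (E c e) + of_bool (E c f) + of_bool (E d e) + of_bool (E d f) = (3::nat)"
  proof -
    have col5: "of_bool (E a x0) + of_bool (E b x0) + of_bool (E c x0) + of_bool (E d x0) + of_bool (E e x0) + of_bool (E f x0) = (2::nat)"
     "of_bool (E a x1) + of_bool (E b x1) + of_bool (E c x1) + of_bool (E d x1) + of_bool (E e x1) + of_bool (E f x1) = (2::nat)"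
     "of_bool (E a x2) + of_bool (E b x2) + of_bool (E c x2) + of_bool (E d x2) + of_bool (E e x2) + of_bool (E f x2) = (2::nat)"
     "of_bool (E a x3) + of_bool (E b x3) + of_bool (E c x3) + of_bool (E d x3) + of_bool (E e x3) + of_bool (E f x3) = (2::nat)"
     "of_bool (E a x4) + of_bool (E b x4) + of_bool (E c x4) + of_bool (E d x4) + of_bool (E e x4) + of_bool (E f x4) = (2::nat)"
      by (rule col, simp only: insert_iff simp_thms)+
    have \<beta>: "\<beta> u = of_bool (E u x0) + of_bool (E u x1) + of_bool (E u x2) + of_bool (E u x3) + of_bool (E u x4)" for u
      by (simp only: \<beta>_def list.map sum_list.Cons sum_list.Nil add.assoc add_0_right)
    have "\<beta> a + \<beta> b + \<beta> c + \<beta> d + \<beta> e + \<beta> f = 10"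
      unfolding \<beta> using col5 by linarith
    then show ?thesis using row by linarith
  qed
  then consider "E c e" "E c f" "E d e" "\<not> E d f" | "E d e" "E d f" "E c e" "\<not> E c f"
    | "E c f" "E c e" "E d f" "\<not> E d e" | "E d f" "E d e" "E c f" "\<not> E c e"
    by (simp only: of_bool_def split: if_splits) simp_all
  then show ?thesis
  proof cases
    case 1
    show ?thesis by (rule circ13_core[OF dist V tf no5 deg v w X p 1])
  next
    case 2
    have "distinct [v,w,a,b,d,c,e,f,x0,x1,x2,x3,x4]" "V = set [v,w,a,b,d,c,e,f,x0,x1,x2,x3,x4]"
      using dist V by auto
    from circ13_core[OF this tf no5 deg v(1,2,4,3,5-7) w(1-4,6,5) X p 2] show ?thesis .
  next
    case 3
    have "distinct [v,w,a,b,c,d,f,e,x0,x1,x2,x3,x4]" "V = set [v,w,a,b,c,d,f,e,x0,x1,x2,x3,x4]"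
      using dist V by auto
    from circ13_core[OF this tf no5 deg v(1-5,7,6) w(1,2,4,3,5,6) X p 3] show ?thesis .
  next
    case 4
    have "distinct [v,w,a,b,d,c,f,e,x0,x1,x2,x3,x4]" "V = set [v,w,a,b,d,c,f,e,x0,x1,x2,x3,x4]"
      using dist V by auto
    from circ13_core[OF this tf no5 deg v(1,2,4,3,5,7,6) w(1,2,4,3,6,5) X p 4] show ?thesis .
  qed
qed

text \<open>All degrees are 4, since fewer than four neighbours would leave nine non-neighbours for
  \<open>ramsey_3_4\<close>. Nonadjacent \<open>v\<close>, \<open>w\<close> with \<open>q\<close>
  common neighbours leave \<open>3 + q\<close> vertices nonadjacent to both, among which no three
  are stable; so \<open>q \<le> 2\<close> by \<open>ramsey_3_3\<close>, and for \<open>q = 2\<close>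
  these vertices form a pentagon.\<close>

lemma circ13_of_ramsey:
  assumes c13: "card V = 13" and tf: "triangle_free V" and no5: "\<not> (\<exists>S\<subseteq>V. stable S \<and> card S = 5)"
  shows "circ13 V"
proof -
  have fin: "finite V" using c13 card.infinite by fastforce
  have com: "E p q = E q p" for p q using sym by blast
  have deg: "card (nbrs V u) = 4" if u: "u \<in> V" for u
  proof -
    have "\<not> 5 \<le> card (nbrs V u)"
      using stable_subset_card[OF stable_nbrs[OF tf u] nbrs_subset] no5 by blast
    moreover have "\<not> card (nbrs V u) \<le> 3"
    proof
      assume "card (nbrs V u) \<le> 3"
      then have "9 \<le> card (V - insert u (nbrs V u))" using card_non_nbrs[OF fin u] c13 by simp
      then obtain T where T: "T \<subseteq> V - insert u (nbrs V u)" "stable T" "card T = 4"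
        using ramsey_3_4[of "V - insert u (nbrs V u)"] fin tf triangle_free_mono by (metis Diff_subset finite_Diff)
      then show False using stable_extend[OF fin u T(1,2)] no5 by simp
    qed
    ultimately show ?thesis by linarith
  qed
  define X where "X v w = V - insert v (nbrs V v) - insert w (nbrs V w)" for v w
  have cX: "card (X v w) + 8 = 11 + card (nbrs V v \<inter> nbrs V w)" if vw: "v \<in> V" "w \<in> V" "v \<noteq> w" "\<not> E v w" for v w
  proof -
    have "v \<notin> nbrs V v" "v \<notin> nbrs V w" "w \<notin> nbrs V v" "w \<notin> nbrs V w" using vw irrefl com by (auto simp: nbrs_def)
    then have "card ({v, w} \<union> (nbrs V v \<union> nbrs V w)) = 2 + card (nbrs V v \<union> nbrs V w)"
      using vw fin by (subst card_Un_disjoint) (auto simp: finite_nbrs)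
    moreover have "card (nbrs V v \<union> nbrs V w) + card (nbrs V v \<inter> nbrs V w) = 8"
      using card_Un_Int[of "nbrs V v" "nbrs V w"] deg vw fin by (simp add: finite_nbrs)
    moreover have "X v w = V - ({v, w} \<union> (nbrs V v \<union> nbrs V w))" by (auto simp: X_def)
    moreover have "{v, w} \<union> (nbrs V v \<union> nbrs V w) \<subseteq> V" using vw nbrs_subset by blast
    then have "card (V - ({v, w} \<union> (nbrs V v \<union> nbrs V w))) + card ({v, w} \<union> (nbrs V v \<union> nbrs V w)) = 13"
      using fin c13 by (metis card_Diff_subset card_mono finite_subset le_add_diff_inverse2)
    ultimately show ?thesis by simp
  qed
  have noX: "\<not> (\<exists>S\<subseteq>X v w. stable S \<and> card S = 3)" if vw: "v \<in> V" "w \<in> V" "v \<noteq> w" "\<not> E v w" for v w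
  proof
    assume "\<exists>S\<subseteq>X v w. stable S \<and> card S = 3"
    then obtain S where S: "S \<subseteq> X v w" "stable S" "card S = 3" by blast
    have "finite S" using S(3) card.infinite by fastforce
    moreover have "v \<notin> insert w S" "w \<notin> S" using S(1) vw(3) by (auto simp: X_def)
    ultimately have "card (insert v (insert w S)) = 5" using S(3) by simp
    moreover have "stable (insert v (insert w S))"
      using S(1,2) vw by (auto simp: stable_insert_iff X_def nbrs_def)
    moreover have "insert v (insert w S) \<subseteq> V" using S(1) vw by (auto simp: X_def)
    ultimately show False using no5 by blast
  qed
  have XV: "X v w \<subseteq> V" for v w by (auto simp: X_def)
  have codeg: "card (nbrs V v \<inter> nbrs V w) \<le> 2" if vw: "v \<in> V" "w \<in> V" "v \<noteq> w" "\<not> E v w" for v w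
  proof (rule ccontr)
    assume "\<not> ?thesis"
    then have "6 \<le> card (X v w)" using cX[OF vw] by linarith
    then show False
      using ramsey_3_3[of "X v w"] noX[OF vw] finite_subset[OF XV fin] triangle_free_mono[OF tf XV] by blast
  qed
  obtain v where v: "v \<in> V" using c13 by fastforce
  have "\<exists>w\<in>V. v \<noteq> w \<and> \<not> E v w \<and> card (nbrs V v \<inter> nbrs V w) \<noteq> 1 \<and> card (nbrs V v \<inter> nbrs V w) \<noteq> 0"
  proof (rule ccontr)
    assume no: "\<not> ?thesis"
    \<comment> \<open>If all codegrees were at most 1, the four neighbours of \<open>v\<close> would
      have disjoint sets of three further neighbours: 12 vertices among the 8 non-neighbours of
      \<open>v\<close>.\<close>
    define B where "B a = nbrs V a - {v}" for a
    have disj: "B a \<inter> B a' = {}" if a: "a \<in> nbrs V v" "a' \<in> nbrs V v" "a \<noteq> a'" for a a'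
    proof (rule ccontr)
      assume "B a \<inter> B a' \<noteq> {}"
      then obtain w where w: "w \<in> V" "w \<noteq> v" "E a w" "E a' w" by (auto simp: B_def nbrs_def)
      then have "\<not> E v w" using tfreeD[OF tf v _ w(1), of a] a(1) by (auto simp: nbrs_def)
      moreover have "{a, a'} \<subseteq> nbrs V v \<inter> nbrs V w" using a w com by (auto simp: nbrs_def)
      then have "card {a, a'} \<le> card (nbrs V v \<inter> nbrs V w)"
        using fin by (intro card_mono) (auto simp: finite_nbrs)
      then have "2 \<le> card (nbrs V v \<inter> nbrs V w)" using a(3) by simp
      ultimately show False using no w by auto
    qed
    have "card (B a) = 3" if "a \<in> nbrs V v" for a
    proof -
      have "a \<in> V" "v \<in> nbrs V a" using that v com by (auto simp: nbrs_def)
      then show ?thesis using deg[of a] fin by (simp add: B_def finite_nbrs)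
    qed
    then have "card (\<Union>a\<in>nbrs V v. B a) = (\<Sum>a\<in>nbrs V v. 3)"
      using disj fin by (subst card_UN_disjoint) (auto simp: finite_nbrs B_def)
    moreover have "(\<Union>a\<in>nbrs V v. B a) \<subseteq> V - insert v (nbrs V v)"
      using tfreeD[OF tf] v com unfolding B_def nbrs_def by blast
    then have "card (\<Union>a\<in>nbrs V v. B a) \<le> card (V - insert v (nbrs V v))"
      using fin by (intro card_mono) auto
    ultimately show False using card_non_nbrs[OF fin v] c13 deg[OF v] by simp
  qed
  then obtain w where w: "w \<in> V" "v \<noteq> w" "\<not> E v w" and "card (nbrs V v \<inter> nbrs V w) = 2"
    using codeg[OF v] by (metis One_nat_def Suc_1 le_SucE le_0_eq less_one numeral_2_eq_2)
  note vw = v w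
  have I2: "card (nbrs V v \<inter> nbrs V w) = 2" by fact
  then obtain a b where ab: "nbrs V v \<inter> nbrs V w = {a, b}" "a \<noteq> b" by (auto simp: card_2_iff)
  have "card (nbrs V v - nbrs V w) = 2" using I2 deg[OF v] fin
    by (simp add: card_Diff_subset_Int finite_nbrs)
  then obtain c d where cd: "nbrs V v - nbrs V w = {c, d}" "c \<noteq> d" by (auto simp: card_2_iff)
  have "card (nbrs V w - nbrs V v) = 2" using I2 deg[OF w(1)] fin
    by (simp add: card_Diff_subset_Int finite_nbrs Int_commute)
  then obtain e f where ef: "nbrs V w - nbrs V v = {e, f}" "e \<noteq> f" by (auto simp: card_2_iff)
  have "card (X v w) = 5" using cX[OF vw] I2 by simp
  then have "pentagon (X v w)"
    using pentagon_of_ramsey noX[OF vw] triangle_free_mono[OF tf XV] by blast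
  then obtain x0 x1 x2 x3 x4 where x: "X v w = {x0, x1, x2, x3, x4}" and p: "pent x0 x1 x2 x3 x4"
    by (rule pentagonE)
  have nv: "nbrs V v = {a, b, c, d}" and nw: "nbrs V w = {a, b, e, f}" using ab cd ef by blast+
  have d1: "{a,b} \<inter> {c,d} = {}" "{a,b} \<inter> {e,f} = {}" "{c,d} \<inter> {e,f} = {}" using ab cd ef by blast+
  have d2: "v \<notin> nbrs V v \<union> nbrs V w" "w \<notin> nbrs V v \<union> nbrs V w" using vw irrefl com by (auto simp: nbrs_def)
  have d3: "{x0,x1,x2,x3,x4} \<inter> ({v, w} \<union> nbrs V v \<union> nbrs V w) = {}" using x by (auto simp: X_def)
  have dist: "distinct [v,w,a,b,c,d,e,f,x0,x1,x2,x3,x4]"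
  proof -
    have "distinct [x0,x1,x2,x3,x4]" using p by (simp add: pent_def)
    moreover have "distinct [v,w,a,b,c,d,e,f]" using d1 d2 ab(2) cd(2) ef(2) w(2) unfolding nv nw by auto
    moreover have "set [x0,x1,x2,x3,x4] \<inter> set [v,w,a,b,c,d,e,f] = {}" using d3 unfolding nv nw by auto
    ultimately have "distinct ([v,w,a,b,c,d,e,f] @ [x0,x1,x2,x3,x4])" by (subst distinct_append) blast
    then show ?thesis by simp
  qed
  have "V = {v, w} \<union> (nbrs V v \<union> nbrs V w) \<union> X v w" using vw nbrs_subset by (auto simp: X_def)
  then have VV: "V = set [v,w,a,b,c,d,e,f,x0,x1,x2,x3,x4]" unfolding nv nw x by auto
  have ev: "E v a" "E v b" "E v c" "E v d" "\<not> E v w" "\<not> E v e" "\<not> E v f"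
    and ew: "E w a" "E w b" "E w e" "E w f" "\<not> E w c" "\<not> E w d"
    using ab cd ef w(3) unfolding nbrs_def by blast+
  have "\<not> E y v \<and> \<not> E y w" if "y \<in> {x0,x1,x2,x3,x4}" for y
  proof -
    have "y \<in> X v w" using that x by simp
    then show ?thesis using com by (auto simp: X_def nbrs_def)
  qed
  from circ13_of_codegree_2[OF dist VV tf no5 deg ev ew this p] show ?thesis .
qed

text \<open>A class of a critical graph has \<open>2 * m + 1\<close> vertices and contributes \<open>m + 1\<close> to the chromatic number;
  the excess over its stability number is at most \<open>m / 2\<close>, and equality forces the extremal pieces.\<close>

lemma odd_triangle_free_stable:
  assumes C: "card C = 2 * m + 1" "m \<le> 6" and tf: "triangle_free C"
  shows "\<exists>S\<subseteq>C. stable S \<and> 2 * (m + 1) \<le> m + 2 * card S \<and>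
    (2 * (m + 1) < m + 2 * card S \<or> m = 0 \<or> m = 2 \<and> pentagon C \<or> m = 6 \<and> circ13 C)"
proof -
  have fin: "finite C" using C(1) card.infinite by fastforce
  have ex: ?thesis if "\<exists>S\<subseteq>C. stable S \<and> card S = s" "2 * (m + 1) \<le> m + 2 * s"
    "2 * (m + 1) < m + 2 * s \<or> m = 0 \<or> m = 2 \<and> pentagon C \<or> m = 6 \<and> circ13 C" for s
    using that by auto
  \<comment> \<open>The required size \<open>(m + 2) / 2\<close> is met with equality only by the
    sizes 1, 2, 4 for \<open>m = 0, 2, 6\<close>. For \<open>m = 1, 3, 4, 5\<close> the Ramsey
    bounds give 2, 3, 4, 4, which is strictly more.\<close>
  consider "m = 0" | "m = 1" | "m = 2" | "m = 3" | "m = 4" | "m = 5" | "m = 6" using C(2) by linarith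
  then show ?thesis
  proof cases
    case 1
    then obtain x where "C = {x}" using C(1) by (auto simp: card_1_singleton_iff)
    then have "\<exists>S\<subseteq>C. stable S \<and> card S = 1"
      by (intro exI[of _ C]) (simp add: stable_def irrefl)
    then show ?thesis using 1 by (intro ex[of 1]) auto
  next
    case 2
    then show ?thesis using stable_pair[OF fin tf] C(1) by (intro ex[of 2]) auto
  next
    case 3
    show ?thesis
    proof (cases "\<exists>S\<subseteq>C. stable S \<and> card S = 3")
      case True then show ?thesis using 3 by (intro ex[of 3]) auto
    next
      case False
      then have "pentagon C" using pentagon_of_ramsey C(1) 3 tf by simp
      then show ?thesis using 3 stable_pair[OF fin tf] C(1) by (intro ex[of 2]) auto
    qed
  next
    case 4
    then show ?thesis using ramsey_3_3[OF fin tf] C(1) by (intro ex[of 3]) auto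
  next
    case 5
    then show ?thesis using ramsey_3_4[OF fin tf] C(1) by (intro ex[of 4]) auto
  next
    case 6
    then show ?thesis using ramsey_3_4[OF fin tf] C(1) by (intro ex[of 4]) auto
  next
    case 7
    show ?thesis
    proof (cases "\<exists>S\<subseteq>C. stable S \<and> card S = 5")
      case True then show ?thesis using 7 by (intro ex[of 5]) auto
    next
      case False
      then have "circ13 C" using circ13_of_ramsey C(1) 7 tf by simp
      then show ?thesis using 7 ramsey_3_4[OF fin tf] C(1) by (intro ex[of 4]) auto
    qed
  qed
qed

subsection \<open>Graphs with chromatic excess at most three\<close>

definition pentagon_decomp :: "'a set \<Rightarrow> nat \<Rightarrow> 'a set set \<Rightarrow> bool" where
  "pentagon_decomp V c \<C> \<longleftrightarrow> \<Union>\<C> = V \<and> disjoint \<C> \<and> (\<forall>C\<in>\<C>. card C = 1 \<or> pentagon C) \<and>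
     card {C\<in>\<C>. pentagon C} = c \<and> (\<forall>u\<in>V. \<forall>v\<in>V. E u v \<longrightarrow> (\<exists>C\<in>\<C>. u \<in> C \<and> v \<in> C))"

definition padded_circ13 :: "'a set \<Rightarrow> bool" where
  "padded_circ13 V \<longleftrightarrow> (\<exists>W\<subseteq>V. circ13 W \<and> (\<forall>u\<in>V. \<forall>v\<in>V. E u v \<longrightarrow> u \<in> W \<and> v \<in> W))"

text \<open>Here \<open>k\<close> is only a lower bound for the number of colours and need not be
  attained. Deleting vertices can therefore violate only the colouring condition.\<close>

definition extremal_hyp :: "'a set \<Rightarrow> nat \<Rightarrow> nat \<Rightarrow> bool" where
  "extremal_hyp V k c \<longleftrightarrow> finite V \<and> (\<forall>m. ccol V m \<longrightarrow> k \<le> m) \<and>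
     (\<forall>S\<subseteq>V. stable S \<longrightarrow> card S + c \<le> k) \<and> card V \<le> k + 2 * c \<and> c \<le> 3"

lemma stable_UN:
  assumes d: "disjoint \<C>" and S: "\<And>C. C \<in> \<C> \<Longrightarrow> S C \<subseteq> C" "\<And>C. C \<in> \<C> \<Longrightarrow> stable (S C)"
    and edge: "\<And>u v. u \<in> \<Union>\<C> \<Longrightarrow> v \<in> \<Union>\<C> \<Longrightarrow> E u v \<Longrightarrow> \<exists>C\<in>\<C>. u \<in> C \<and> v \<in> C"
  shows "stable (\<Union>C\<in>\<C>. S C)"
  unfolding stable_def
proof (intro ballI notI)
  fix u v assume uv: "u \<in> (\<Union>C\<in>\<C>. S C)" "v \<in> (\<Union>C\<in>\<C>. S C)" "E u v"
  then obtain C D where CD: "C \<in> \<C>" "u \<in> S C" "D \<in> \<C>" "v \<in> S D" by blast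
  then have uvC: "u \<in> C" "v \<in> D" using S(1) by blast+
  then obtain B where B: "B \<in> \<C>" "u \<in> B" "v \<in> B" using edge[OF _ _ uv(3)] CD(1,3) by blast
  then have "B = C" "B = D" using d uvC CD(1,3) unfolding disjoint_def by blast+
  then show False using S(2)[OF CD(1)] CD uv(3) unfolding stable_def by blast
qed

text \<open>The number \<open>\<nu> = card V - k\<close> is the matching number: a larger matching
  would colour \<open>V\<close> with fewer than \<open>k\<close> colours, and criticality turns a
  colouring of \<open>V - {v}\<close> into a matching of size \<open>\<nu>\<close> that misses
  \<open>v\<close>. These are the hypotheses of Gallai's lemma.\<close>

lemma extremal_triangle_free_critical:
  assumes hyp: "extremal_hyp V k c" and tf: "triangle_free V"
    and crit: "\<And>v. v \<in> V \<Longrightarrow> \<exists>m<k. ccol (V - {v}) m"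
  shows "card V = k + 2 * c \<and> ((\<exists>\<C>. pentagon_decomp V c \<C>) \<or> c = 3 \<and> padded_circ13 V)"
proof -
  have fin: "finite V" and col: "\<And>m. ccol V m \<Longrightarrow> k \<le> m"
    and st: "\<And>S. S \<subseteq> V \<Longrightarrow> stable S \<Longrightarrow> card S + c \<le> k" and n: "card V \<le> k + 2 * c" and c3: "c \<le> 3"
    using hyp by (auto simp: extremal_hyp_def)
  define \<nu> where "\<nu> = card V - k"
  have kn: "k \<le> card V" using col ccol_card[OF fin] .
  have max: "card M \<le> \<nu>" if M: "matching V M" for M
  proof -
    have "2 * card M \<le> card V"
      using matching_card_Union[OF M fin] matching_Union[OF M] fin card_mono by metis
    then show ?thesis using col[OF ccol_matching[OF M fin]] kn by (simp add: \<nu>_def)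
  qed
  have miss: "\<exists>M. matching V M \<and> card M = \<nu> \<and> v \<notin> \<Union>M" if v: "v \<in> V" for v
  proof -
    obtain m where m: "m < k" "ccol (V - {v}) m" using crit[OF v] by blast
    obtain M where M: "matching (V - {v}) M" "card (V - {v}) \<le> m + card M"
      using matching_of_ccol[OF m(2)] triangle_free_mono[OF tf] fin by blast
    have M': "matching V M" using matching_mono[OF M(1)] by blast
    have "card (V - {v}) = card V - 1" using v fin by simp
    then have "\<nu> \<le> card M" using M(2) m(1) by (simp add: \<nu>_def)
    then have "card M = \<nu>" using max[OF M'] by simp
    moreover have "v \<notin> \<Union>M" using matching_Union[OF M(1)] by blast
    ultimately show ?thesis using M' by blast
  qed
  have ex: "\<exists>M. matching V M \<and> card M = \<nu>"
  proof (cases "V = {}")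
    case True then show ?thesis by (intro exI[of _ "{}"]) (simp add: matching_def \<nu>_def)
  next
    case False then show ?thesis using miss by blast
  qed
  obtain \<C> where U: "\<Union>\<C> = V" and d: "disjoint \<C>" and ne: "{} \<notin> \<C>" and odd: "\<And>C. C \<in> \<C> \<Longrightarrow> odd (card C)"
    and edge: "\<And>u v. u \<in> V \<Longrightarrow> v \<in> V \<Longrightarrow> E u v \<Longrightarrow> \<exists>C\<in>\<C>. u \<in> C \<and> v \<in> C"
    and cV: "card V = 2 * \<nu> + card \<C>"
    using gallai_partition[of V \<nu>, OF fin max miss ex] by blast
  have finC: "finite \<C>" using U fin finite_UnionD by metis
  have finCC: "finite C" if "C \<in> \<C>" for C using that U fin by (metis Union_upper finite_subset)
  define m where "m C = card C div 2" for C :: "'a set"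
  have cm: "card C = 2 * m C + 1" if "C \<in> \<C>" for C using odd[OF that] by (simp add: m_def)
  have "card V = (\<Sum>C\<in>\<C>. card C)"
    unfolding U[symmetric] using finCC d
    by (intro card_Union_disjoint) (auto simp: disjoint_def pairwise_def disjnt_def)
  also have "\<dots> = (\<Sum>C\<in>\<C>. 2 * m C + 1)" using cm by (rule sum.cong[OF refl])
  also have "\<dots> = 2 * (\<Sum>C\<in>\<C>. m C) + card \<C>"
    by (simp only: sum.distrib sum_distrib_left) simp
  finally have sm: "(\<Sum>C\<in>\<C>. m C) = \<nu>" using cV by simp
  have \<nu>c: "\<nu> \<le> 2 * c" using n by (simp add: \<nu>_def)
  have m6: "m C \<le> 6" if "C \<in> \<C>" for C
    using member_le_sum[OF that, of m] finC sm \<nu>c c3 by simp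
  have "\<forall>C\<in>\<C>. \<exists>S\<subseteq>C. stable S \<and> 2 * (m C + 1) \<le> m C + 2 * card S \<and>
    (2 * (m C + 1) < m C + 2 * card S \<or> m C = 0 \<or> m C = 2 \<and> pentagon C \<or> m C = 6 \<and> circ13 C)"
  proof
    fix C assume C: "C \<in> \<C>"
    then have "triangle_free C" using triangle_free_mono[OF tf] U by blast
    then show "\<exists>S\<subseteq>C. stable S \<and> 2 * (m C + 1) \<le> m C + 2 * card S \<and>
    (2 * (m C + 1) < m C + 2 * card S \<or> m C = 0 \<or> m C = 2 \<and> pentagon C \<or> m C = 6 \<and> circ13 C)"
      by (rule odd_triangle_free_stable[OF cm[OF C] m6[OF C]])
  qed
  from bchoice[OF this] obtain S where S: "\<And>C. C \<in> \<C> \<Longrightarrow> S C \<subseteq> C" "\<And>C. C \<in> \<C> \<Longrightarrow> stable (S C)"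
    "\<And>C. C \<in> \<C> \<Longrightarrow> 2 * (m C + 1) \<le> m C + 2 * card (S C)"
    "\<And>C. C \<in> \<C> \<Longrightarrow> 2 * (m C + 1) < m C + 2 * card (S C) \<or> m C = 0 \<or> m C = 2 \<and> pentagon C \<or> m C = 6 \<and> circ13 C"
    by blast
  have "stable (\<Union>C\<in>\<C>. S C)" using stable_UN[OF d S(1,2)] edge unfolding U by blast
  moreover have "(\<Union>C\<in>\<C>. S C) \<subseteq> V" using S(1) U by blast
  ultimately have "card (\<Union>C\<in>\<C>. S C) + c \<le> k" using st by blast
  moreover have "card (\<Union>C\<in>\<C>. S C) = (\<Sum>C\<in>\<C>. card (S C))"
  proof (rule card_UN_disjoint[OF finC])
    show "\<forall>C\<in>\<C>. finite (S C)" using S(1) finCC finite_subset by blast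
    show "\<forall>i\<in>\<C>. \<forall>j\<in>\<C>. i \<noteq> j \<longrightarrow> S i \<inter> S j = {}" using S(1) d unfolding disjoint_def by blast
  qed
  ultimately have sS: "(\<Sum>C\<in>\<C>. card (S C)) + c \<le> \<nu> + card \<C>" using cV kn by (simp add: \<nu>_def)
  \<comment> \<open>Here \<open>k = \<nu> + card \<C>\<close>, so \<open>c\<close> is at most the
    sum of \<open>m C + 1 - card (S C)\<close>, which is at most half the sum of \<open>m C\<close>,
    that is \<open>\<nu> / 2 \<le> c\<close>. Equality holds throughout, hence in every
    class.\<close>
  have lhs: "(\<Sum>C\<in>\<C>. 2 * (m C + 1)) = 2 * \<nu> + 2 * card \<C>"
    by (simp only: sum.distrib sum_distrib_left[symmetric] sm) simp
  have rhs: "(\<Sum>C\<in>\<C>. m C + 2 * card (S C)) = \<nu> + 2 * (\<Sum>C\<in>\<C>. card (S C))"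
    using sm by (simp add: sum.distrib sum_distrib_left[symmetric])
  have le: "(\<Sum>C\<in>\<C>. 2 * (m C + 1)) \<le> (\<Sum>C\<in>\<C>. m C + 2 * card (S C))"
    using S(3) by (rule sum_mono)
  have eq\<nu>: "\<nu> = 2 * c" using le lhs rhs sS \<nu>c by linarith
  have tight: "m C = 0 \<or> m C = 2 \<and> pentagon C \<or> m C = 6 \<and> circ13 C" if C: "C \<in> \<C>" for C
  proof (rule ccontr)
    assume "\<not> ?thesis"
    then have "2 * (m C + 1) < m C + 2 * card (S C)" using S(4)[OF C] by blast
    then have "(\<Sum>C\<in>\<C>. 2 * (m C + 1)) < (\<Sum>C\<in>\<C>. m C + 2 * card (S C))"
      using S(3) C by (intro sum_strict_mono_ex1[OF finC]) auto
    then show False using lhs rhs sS eq\<nu> by linarith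
  qed
  have first: "card V = k + 2 * c" using eq\<nu> kn by (simp add: \<nu>_def)
  show ?thesis
  proof (cases "\<exists>W\<in>\<C>. m W = 6")
    case True
    then obtain W where W: "W \<in> \<C>" "m W = 6" by blast
    \<comment> \<open>A single class with \<open>m W = 6\<close> uses up all of
      \<open>\<nu> = 2 * c \<le> 6\<close>.\<close>
    have s: "m W + (\<Sum>C\<in>\<C>-{W}. m C) = \<nu>" using sum.remove[OF finC W(1), of m] sm by simp
    have c: "c = 3" and r: "(\<Sum>C\<in>\<C>-{W}. m C) = 0" using s W(2) eq\<nu> c3 by linarith+
    have r0: "m C = 0" if "C \<in> \<C>" "C \<noteq> W" for C using r that finC by simp
    have "u \<in> W \<and> v \<in> W" if uv: "u \<in> V" "v \<in> V" "E u v" for u v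
    proof -
      obtain B where B: "B \<in> \<C>" "u \<in> B" "v \<in> B" using edge[OF uv] by blast
      have "B = W"
      proof (rule ccontr)
        assume "B \<noteq> W"
        then have "card B = 1" using cm[OF B(1)] r0[OF B(1)] by simp
        then have "u = v" using B by (auto simp: card_1_singleton_iff)
        then show False using uv(3) irrefl by simp
      qed
      then show ?thesis using B by simp
    qed
    moreover have "circ13 W" using tight[OF W(1)] W(2) by simp
    moreover have "W \<subseteq> V" using W U by blast
    ultimately have "padded_circ13 V" unfolding padded_circ13_def by blast
    then show ?thesis using first c by blast
  next
    case False
    have t: "card C = 1 \<or> pentagon C" "m C = (if pentagon C then 2 else 0)" if C: "C \<in> \<C>" for C
    proof -
      have "m C \<noteq> 6" using False C by metis
      then have "m C = 0 \<or> m C = 2 \<and> pentagon C" using tight[OF C] by simp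
      moreover have "m C = 2" if "pentagon C" using card_pentagon[OF that] by (simp add: m_def)
      moreover have "card C = 1" if "m C = 0" using cm[OF C] that by simp
      ultimately show "card C = 1 \<or> pentagon C" "m C = (if pentagon C then 2 else 0)"
        by presburger+
    qed
    have "2 * c = (\<Sum>C\<in>\<C>. 2 * (if pentagon C then 1 else 0))"
      unfolding eq\<nu>[symmetric] sm[symmetric] using t(2) by (intro sum.cong) auto
    also have "\<dots> = 2 * card {C\<in>\<C>. pentagon C}"
      unfolding sum_distrib_left[symmetric] sum_bool_card[OF finC] ..
    finally have "card {C\<in>\<C>. pentagon C} = c" by simp
    then have "pentagon_decomp V c \<C>" unfolding pentagon_decomp_def using U d t(1) edge by blast
    then show ?thesis using first by blast
  qed
qed

section \<open>Removal of triangles and the induction\<close>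

definition extremal :: "'a set \<Rightarrow> nat \<Rightarrow> nat \<Rightarrow> bool" where
  "extremal V k c \<longleftrightarrow> card V = k + 2 * c \<and> ((\<exists>\<C>. pentagon_decomp V c \<C>) \<or> c = 3 \<and> padded_circ13 V)"

definition pairwise_adj :: "'a set \<Rightarrow> bool" where
  "pairwise_adj Q \<longleftrightarrow> (\<forall>u\<in>Q. \<forall>v\<in>Q. u = v \<or> E u v)"

text \<open>\<open>Q\<close> can be one colour class, and a stable set of \<open>V - Q\<close> is
  one of \<open>V\<close>; three removed vertices pay exactly for the decrease of
  \<open>k + 2 * c\<close> by three.\<close>

lemma extremal_hyp_remove_clique:
  assumes hyp: "extremal_hyp V k c" and Q: "Q \<subseteq> V" "pairwise_adj Q" "3 \<le> card Q"
  shows "0 < c" "0 < k" "extremal_hyp (V - Q) (k - 1) (c - 1)" "card (V - Q) + card Q = card V"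
proof -
  have fin: "finite V" and col: "\<And>m. ccol V m \<Longrightarrow> k \<le> m"
    and st: "\<And>S. S \<subseteq> V \<Longrightarrow> stable S \<Longrightarrow> card S + c \<le> k" and n: "card V \<le> k + 2 * c" and c3: "c \<le> 3"
    using hyp by (auto simp: extremal_hyp_def)
  have cQ: "ccol Q 1" using Q(2) by (intro ccol_clique) (auto simp: pairwise_adj_def)
  have VQ: "Q \<union> (V - Q) = V" using Q(1) by blast
  have col': "k \<le> 1 + m" if "ccol (V - Q) m" for m
    using col ccol_Un[OF cQ that] unfolding VQ by blast
  show cd: "card (V - Q) + card Q = card V"
    using Q(1) fin by (metis card_Diff_subset card_mono finite_subset le_add_diff_inverse2)
  \<comment> \<open>One colour for \<open>Q\<close> and one for each other vertex give
    \<open>card V \<ge> k + 2\<close>, which is compatible with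
    \<open>card V \<le> k + 2 * c\<close> only if \<open>c > 0\<close>.\<close>
  have "k \<le> 1 + card (V - Q)" using fin by (intro col' ccol_card) auto
  then show c0: "0 < c" using cd Q(3) n by linarith
  show "0 < k" using st[of "{}"] c0 by (simp add: stable_empty)
  show "extremal_hyp (V - Q) (k - 1) (c - 1)"
    unfolding extremal_hyp_def
  proof (intro conjI allI impI)
    fix m assume "ccol (V - Q) m"
    then show "k - 1 \<le> m" using col' by fastforce
  next
    fix S assume "S \<subseteq> V - Q" "stable S"
    then have "card S + c \<le> k" using st by blast
    then show "card S + (c - 1) \<le> k - 1" using c0 by linarith
  qed (use fin cd n Q(3) c0 c3 in auto)
qed

text \<open>\<open>t\<close> is adjacent to some vertex of every maximum stable set of the piece \<open>C\<close>.\<close>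

definition covers :: "'a \<Rightarrow> 'a set \<Rightarrow> bool" where
  "covers t C \<longleftrightarrow> (\<exists>i. C = {i} \<and> E t i) \<or>
     (\<exists>x y z w u. C = {x, y, z, w, u} \<and> pent x y z w u \<and> E t z \<and> E t w \<and> E t u)"

lemma pentagon_decomp_same:
  assumes "pentagon_decomp V c \<C>" "u \<in> V" "v \<in> V" "E u v" "C \<in> \<C>" "u \<in> C" shows "v \<in> C"
proof -
  obtain B where B: "B \<in> \<C>" "u \<in> B" "v \<in> B" using assms unfolding pentagon_decomp_def by blast
  have "disjoint \<C>" using assms(1) by (simp add: pentagon_decomp_def)
  then have "B = C" using B assms(5,6) unfolding disjoint_def by blast
  then show ?thesis using B by simp
qed

lemma card_pentagon_decomp:
  assumes "pentagon_decomp V c \<C>" "finite V" shows "finite \<C>" "card V = card \<C> + 4 * c"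
proof -
  have U: "\<Union>\<C> = V" and d: "disjoint \<C>" and t: "\<And>C. C \<in> \<C> \<Longrightarrow> card C = 1 \<or> pentagon C"
    and c: "card {C\<in>\<C>. pentagon C} = c" using assms(1) by (auto simp: pentagon_decomp_def)
  show f: "finite \<C>" using U assms(2) finite_UnionD by metis
  have "card V = (\<Sum>C\<in>\<C>. card C)"
    unfolding U[symmetric] using U assms(2) d
    by (intro card_Union_disjoint) (auto simp: disjoint_def pairwise_def disjnt_def intro: finite_subset)
  also have "\<dots> = (\<Sum>C\<in>\<C>. 1 + 4 * (if pentagon C then 1 else 0))"
  proof (rule sum.cong[OF refl])
    fix C assume "C \<in> \<C>"
    then show "card C = 1 + 4 * (if pentagon C then 1 else 0)" using t[of C] card_pentagon[of C] by auto
  qed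
  also have "\<dots> = card \<C> + 4 * c"
    by (simp only: sum.distrib sum_distrib_left[symmetric] sum_bool_card[OF f] c) simp
  finally show "card V = card \<C> + 4 * c" .
qed

definition nonisolated :: "'a set \<Rightarrow> 'a set" where
  "nonisolated V = {u\<in>V. \<exists>v\<in>V. E u v}"

text \<open>This count does not depend on the decomposition, so it compares the remainders after two
  different triangles have been removed.\<close>

lemma card_nonisolated_pentagon_decomp:
  assumes dec: "pentagon_decomp V c \<C>" and fin: "finite V" shows "card (nonisolated V) = 5 * c"
proof -
  have U: "\<Union>\<C> = V" and d: "disjoint \<C>" and t: "\<And>C. C \<in> \<C> \<Longrightarrow> card C = 1 \<or> pentagon C"
    and c: "card {C\<in>\<C>. pentagon C} = c" using dec by (auto simp: pentagon_decomp_def)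
  have "nonisolated V = \<Union>{C\<in>\<C>. pentagon C}"
  proof (intro equalityI subsetI)
    fix u assume "u \<in> nonisolated V"
    then obtain v where uv: "u \<in> V" "v \<in> V" "E u v" by (auto simp: nonisolated_def)
    then obtain C where C: "C \<in> \<C>" "u \<in> C" using U by blast
    then have "v \<in> C" using pentagon_decomp_same[OF dec uv C] by simp
    then have "card C \<noteq> 1" using C uv(3) irrefl by (auto simp: card_1_singleton_iff)
    then show "u \<in> \<Union>{C\<in>\<C>. pentagon C}" using t C by blast
  next
    fix u assume "u \<in> \<Union>{C\<in>\<C>. pentagon C}"
    then obtain C where C: "C \<in> \<C>" "pentagon C" "u \<in> C" by blast
    then obtain y z w x where "C = {u, y, z, w, x}" "pent u y z w x" using pentagon_at by blast
    then have "y \<in> C" "E u y" by (auto simp: pent_def)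
    then show "u \<in> nonisolated V" using C U by (auto simp: nonisolated_def)
  qed
  moreover have "card (\<Union>{C\<in>\<C>. pentagon C}) = (\<Sum>C\<in>{C\<in>\<C>. pentagon C}. card C)"
    using U fin d by (intro card_Union_disjoint) (auto simp: disjoint_def pairwise_def disjnt_def intro: finite_subset)
  ultimately show ?thesis using c card_pentagon by simp
qed

lemma ccol_covered:
  assumes "card C = 1 \<or> pentagon C" "covers t C"
  shows "ccol (insert t C) (if pentagon C then 3 else 1)"
proof (cases "pentagon C")
  case True
  then have "\<exists>v\<in>C. E t v" using assms(2) by (auto simp: covers_def)
  then show ?thesis using ccol_pentagon_insert[OF True] True by auto
next
  case False
  then obtain i where "C = {i}" "E t i" using assms(2) pentagonI by (fastforce simp: covers_def)
  then show ?thesis using ccol_edge[of t i] False by simp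
qed

lemma ccol_component:
  assumes "card C = 1 \<or> pentagon C"
  shows "ccol C (if pentagon C then 3 else 1)"
  using assms ccol_pentagon ccol_card[of C] card.infinite by fastforce

text \<open>By induction, every triangle leaves \<open>c - 1 \<le> 2\<close> pentagons and isolated
  vertices. Counting shows that two vertices of a triangle \<open>T\<close> are covered by the same
  piece; a new triangle formed from this piece and one or two of them gives a second decomposition,
  incompatible with the first.\<close>

lemma extremal_no_triangle:
  assumes hyp: "extremal_hyp V k c"
    and IH: "\<And>V' k' c'. card V' < card V \<Longrightarrow> extremal_hyp V' k' c' \<Longrightarrow> extremal V' k' c'"
  shows "triangle_free V"
  unfolding triangle_free_def
proof (intro ballI notI)
  fix a b d assume abd: "a \<in> V" "b \<in> V" "d \<in> V" "E a b \<and> E b d \<and> E a d"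
  have com: "E p q = E q p" for p q using sym by blast
  have fin: "finite V" and col: "\<And>m. ccol V m \<Longrightarrow> k \<le> m"
    and st: "\<And>S. S \<subseteq> V \<Longrightarrow> stable S \<Longrightarrow> card S + c \<le> k" and c3: "c \<le> 3"
    using hyp by (auto simp: extremal_hyp_def)
  have tri: "\<exists>\<C>. pentagon_decomp (V - T) (c - 1) \<C>" "card V = k + 2 * c" "0 < c" "0 < k"
    if T: "T \<subseteq> V" "pairwise_adj T" "card T = 3" for T
  proof -
    note r = extremal_hyp_remove_clique[OF hyp T(1,2)]
    have "extremal (V - T) (k - 1) (c - 1)" using r T(3) by (intro IH) auto
    then show "\<exists>\<C>. pentagon_decomp (V - T) (c - 1) \<C>" "card V = k + 2 * c" "0 < c" "0 < k"
      using r T(3) c3 by (auto simp: extremal_def)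
  qed
  \<comment> \<open>Four vertices are one too many: equality for the remainder would mean
    \<open>card V = k + 2 * c + 1\<close>.\<close>
  have no4: "False" if T: "T \<subseteq> V" "pairwise_adj T" "card T = 4" for T
  proof -
    note r = extremal_hyp_remove_clique[OF hyp T(1,2)]
    have "extremal (V - T) (k - 1) (c - 1)" using r T(3) by (intro IH) auto
    then have "card V = k + 2 * c + 1" using r T(3) by (auto simp: extremal_def)
    then show False using hyp by (simp add: extremal_hyp_def)
  qed
  define T where "T = {a, b, d}"
  have Tc: "T \<subseteq> V" "pairwise_adj T" "card T = 3" using abd com neqI irrefl by (auto simp: T_def pairwise_adj_def card_insert_if)
  have finT: "finite T" by (simp add: T_def)
  obtain \<C> where dec: "pentagon_decomp (V - T) (c - 1) \<C>" using tri[OF Tc] by blast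
  have cV: "card V = k + 2 * c" and c0: "0 < c" and k0: "0 < k" using tri[OF Tc] by blast+
  have U: "\<Union>\<C> = V - T" and dj: "disjoint \<C>" and t1: "\<And>C. C \<in> \<C> \<Longrightarrow> card C = 1 \<or> pentagon C"
    and cp: "card {C\<in>\<C>. pentagon C} = c - 1"
    and edge: "\<And>u v. u \<in> V - T \<Longrightarrow> v \<in> V - T \<Longrightarrow> E u v \<Longrightarrow> \<exists>C\<in>\<C>. u \<in> C \<and> v \<in> C"
    using dec by (auto simp: pentagon_decomp_def)
  have finC: "finite \<C>" using card_pentagon_decomp[OF dec] fin by blast
  have cVT: "card (V - T) + 3 = card V" using Tc fin card_Diff_subset[OF finT Tc(1)] card_mono[OF fin Tc(1)] by simp
  \<comment> \<open>Both contradictions below come from this identity: a stable set of size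
    \<open>card \<C> + c\<close> is too large by one, and a colouring with
    \<open>card \<C> + 2 * (c - 1)\<close> colours uses only \<open>k - 1\<close>.\<close>
  then have cC: "card \<C> + 2 * c = k + 1" using card_pentagon_decomp(2)[OF dec] fin cV c0 by simp
  \<comment> \<open>Used with \<open>r = 1\<close> for stable sets (two vertices per pentagon) and
    with \<open>r = 2\<close> for colours (three per pentagon).\<close>
  have sum2: "(\<Sum>C\<in>\<C>. 1 + r * (if pentagon C then 1 else 0)) = card \<C> + r * (c - 1)" for r
    by (simp only: sum.distrib sum_distrib_left[symmetric] sum_bool_card[OF finC] cp) simp
  txt \<open>Otherwise \<open>t\<close> could be added to a maximum stable set of \<open>V - T\<close>.\<close>
  have "\<exists>C\<in>\<C>. covers t C" if t: "t \<in> T" for t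
  proof (rule ccontr)
    assume no: "\<not> ?thesis"
    have "\<forall>C\<in>\<C>. \<exists>S\<subseteq>C. stable S \<and> (\<forall>s\<in>S. \<not> E t s) \<and> card S = 1 + 1 * (if pentagon C then 1 else 0)"
    proof
      fix C assume C: "C \<in> \<C>"
      have nc: "\<not> covers t C" using no C by blast
      show "\<exists>S\<subseteq>C. stable S \<and> (\<forall>s\<in>S. \<not> E t s) \<and> card S = 1 + 1 * (if pentagon C then 1 else 0)"
      proof (cases "pentagon C")
        case True
        have "\<not> (\<exists>x y z w u. C = {x, y, z, w, u} \<and> pent x y z w u \<and> E t z \<and> E t w \<and> E t u)"
          using nc by (simp only: covers_def de_Morgan_disj simp_thms)
        then obtain S where "S \<subseteq> C" "stable S" "card S = 2" "\<forall>s\<in>S. \<not> E t s"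
          using pentagon_stable_or_cover[OF True, of t] by blast
        then show ?thesis using True by (intro exI[of _ S]) simp
      next
        case False
        then obtain i where i: "C = {i}" using t1[OF C] by (auto simp: card_1_singleton_iff)
        then have "\<not> E t i" using nc unfolding covers_def by simp
        then show ?thesis using i False by (intro exI[of _ C]) (auto simp: stable_insert_iff stable_empty)
      qed
    qed
    from bchoice[OF this] obtain S where S: "\<And>C. C \<in> \<C> \<Longrightarrow> S C \<subseteq> C" "\<And>C. C \<in> \<C> \<Longrightarrow> stable (S C)"
      "\<And>C. C \<in> \<C> \<Longrightarrow> \<forall>s\<in>S C. \<not> E t s"
      "\<And>C. C \<in> \<C> \<Longrightarrow> card (S C) = 1 + 1 * (if pentagon C then 1 else 0)" by blast
    let ?S = "\<Union>C\<in>\<C>. S C"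
    have sub: "?S \<subseteq> V - T" using S(1) U by blast
    have "card ?S = (\<Sum>C\<in>\<C>. card (S C))"
    proof (rule card_UN_disjoint[OF finC])
      show "\<forall>C\<in>\<C>. finite (S C)"
      proof
        fix C assume C: "C \<in> \<C>"
        have "S C \<subseteq> V" using S(1)[OF C] U C by blast
        then show "finite (S C)" using fin finite_subset by blast
      qed
      show "\<forall>i\<in>\<C>. \<forall>j\<in>\<C>. i \<noteq> j \<longrightarrow> S i \<inter> S j = {}" using S(1) dj unfolding disjoint_def by blast
    qed
    also have "\<dots> = card \<C> + 1 * (c - 1)" using S(4) by (subst sum2[symmetric]) (rule sum.cong[OF refl])
    finally have "card ?S = card \<C> + (c - 1)" by simp
    moreover have "stable (insert t ?S)"
      using stable_UN[OF dj S(1,2)] edge S(3) unfolding U by (auto simp: stable_insert_iff)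
    then have "card (insert t ?S) + c \<le> k" using sub t Tc(1) by (intro st) auto
    moreover have "card (insert t ?S) = Suc (card ?S)"
      using sub t fin by (intro card_insert_disjoint) (auto intro: finite_subset)
    ultimately show False using cC c0 by linarith
  qed
  then have "\<forall>t\<in>T. \<exists>C. C \<in> \<C> \<and> covers t C" by blast
  from bchoice[OF this] obtain K where K: "\<And>t. t \<in> T \<Longrightarrow> K t \<in> \<C>" "\<And>t. t \<in> T \<Longrightarrow> covers t (K t)"
    by blast
  txt \<open>A piece with \<open>2 * m + 1\<close> vertices still needs only \<open>m + 1\<close> colours after one vertex covering it is
    added, so distinct pieces for the three vertices of \<open>T\<close> would give a colouring with \<open>k - 1\<close> colours.\<close>
  have "\<not> inj_on K T"
  proof
    assume inj: "inj_on K T"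
    define g where "g C = C \<union> {t\<in>T. K t = C}" for C
    have "ccol (g C) (1 + 2 * (if pentagon C then 1 else 0))" if C: "C \<in> \<C>" for C
    proof (cases "\<exists>t\<in>T. K t = C")
      case True
      then obtain t where t: "t \<in> T" "K t = C" by blast
      then have "g C = insert t C" using inj by (auto simp: g_def inj_on_def)
      then show ?thesis using ccol_covered[OF t1[OF C]] K(2)[OF t(1)] t(2) by (auto split: if_splits)
    next
      case False
      then have "g C = C" by (auto simp: g_def)
      then show ?thesis using ccol_component[OF t1[OF C]] by (auto split: if_splits)
    qed
    then have "ccol (\<Union>C\<in>\<C>. g C) (card \<C> + 2 * (c - 1))"
      using ccol_UN[OF finC, of g] sum2[of 2] by metis
    moreover have "V \<subseteq> (\<Union>C\<in>\<C>. g C)" using U K(1) by (auto simp: g_def)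
    ultimately have "k \<le> card \<C> + 2 * (c - 1)" using ccol_mono col by blast
    then show False using cC c0 by linarith
  qed
  then obtain t t' where tt: "t \<in> T" "t' \<in> T" "t \<noteq> t'" "K t = K t'" unfolding inj_on_def by blast
  then obtain t'' where T': "T = {t, t', t''}" "t'' \<noteq> t" "t'' \<noteq> t'"
    using Tc(3) unfolding T_def by (auto simp: card_insert_if split: if_splits)
  have Ett: "E t t'" "E t t''" "E t' t''" using Tc(2) T' tt(3) unfolding pairwise_adj_def by auto
  define C where "C = K t"
  have C: "C \<in> \<C>" "covers t C" "covers t' C"
    using K(1)[OF tt(1)] K(2)[OF tt(1)] K(2)[OF tt(2)] tt(4) by (simp_all add: C_def)
  have CV: "C \<subseteq> V - T" using C U by blast
  show False
  proof (cases "card C = 1")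
    case True
    then obtain i where i: "C = {i}" by (auto simp: card_1_singleton_iff)
    then have ti: "E t i" "E t' i" using C(2,3) by (auto simp: covers_def pent_def)
    have iV: "i \<in> V" "i \<notin> T" using CV i by auto
    \<comment> \<open>Exchanging \<open>t''\<close> for \<open>i\<close> puts \<open>t''\<close>
      into the remainder in place of the isolated vertex \<open>i\<close>. As \<open>t''\<close> has
      a neighbour other than \<open>i\<close> there, the number of nonisolated vertices grows,
      although it is \<open>5 * (c - 1)\<close> both times.\<close>
    define T2 where "T2 = {t, t', i}"
    have T2: "T2 \<subseteq> V" "pairwise_adj T2" "card T2 = 3"
    proof -
      have "t \<noteq> i" "t' \<noteq> i" using iV tt by blast+
      then show "card T2 = 3" using tt(3) by (simp add: T2_def)
    qed (use iV tt Tc(1) ti Ett com in \<open>auto simp: T2_def pairwise_adj_def\<close>)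
    obtain \<D> where \<D>: "pentagon_decomp (V - T2) (c - 1) \<D>" using tri[OF T2] by blast
    have nti: "\<not> E t'' i"
    proof
      assume "E t'' i"
      then have "pairwise_adj (insert i T)" using ti Ett com T' by (auto simp: pairwise_adj_def)
      moreover have "card (insert i T) = 4" using Tc(3) iV finT by simp
      ultimately show False using no4[of "insert i T"] iV Tc(1) by auto
    qed
    have iso: "\<not> E i u" if "u \<in> V - T" for u
    proof
      assume "E i u"
      then have "u \<in> C" using pentagon_decomp_same[OF dec _ that _ C(1)] iV i by blast
      then show False using i \<open>E i u\<close> irrefl by simp
    qed
    have sub1: "nonisolated (V - T) \<subseteq> nonisolated (V - T2)"
    proof
      fix u assume "u \<in> nonisolated (V - T)"
      then obtain v where uv: "u \<in> V - T" "v \<in> V - T" "E u v" by (auto simp: nonisolated_def)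
      then have "u \<noteq> i" "v \<noteq> i" using iso com by blast+
      then have "u \<in> V - T2" "v \<in> V - T2" using uv T' by (auto simp: T2_def)
      then show "u \<in> nonisolated (V - T2)" using uv(3) by (auto simp: nonisolated_def)
    qed
    have "t'' \<in> T" using T' by simp
    then have "K t'' \<in> \<C>" "covers t'' (K t'')" using K by blast+
    moreover from this have "\<exists>s\<in>K t''. E t'' s" by (auto simp: covers_def)
    ultimately obtain s where s: "s \<in> V - T" "E t'' s" using U by blast
    then have "s \<in> V - T2" using nti T' by (auto simp: T2_def)
    moreover have "t'' \<in> V - T2" using \<open>t'' \<in> T\<close> Tc(1) T'(2,3) iV by (auto simp: T2_def)
    ultimately have "t'' \<in> nonisolated (V - T2)" using s(2) by (auto simp: nonisolated_def)
    moreover have "t'' \<notin> nonisolated (V - T)" using \<open>t'' \<in> T\<close> by (auto simp: nonisolated_def)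
    ultimately have "nonisolated (V - T) \<subset> nonisolated (V - T2)" using sub1 by blast
    then have "card (nonisolated (V - T)) < card (nonisolated (V - T2))"
      using fin by (intro psubset_card_mono) (auto simp: nonisolated_def)
    then show False using card_nonisolated_pentagon_decomp[OF dec] card_nonisolated_pentagon_decomp[OF \<D>] fin by simp
  next
    case False
    then obtain x y z w u where xC: "C = {x, y, z, w, u}" and p: "pent x y z w u" and tz: "E t z" "E t w" "E t u"
      using C(2) by (auto simp: covers_def)
    obtain x' y' z' w' u' where xC': "C = {x', y', z', w', u'}" and p': "pent x' y' z' w' u'"
      and tz': "E t' z'" "E t' w'" "E t' u'" using C(3) False by (auto simp: covers_def)
    \<comment> \<open>The two vertices of \<open>C\<close> outside the three covered ones are
      adjacent, so every nonadjacent pair meets a neighbour of \<open>t'\<close>.\<close>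
    have cov': "E t' r \<or> E t' s" if "r \<in> C" "s \<in> C" "r \<noteq> s" "\<not> E r s" for r s
      using that tz' p' com unfolding xC' pent_def by auto
    have pd: "distinct [x, y, z, w, u]" "E x y" "E y z" "E z w" "E w u" "E u x" "\<not> E x z" "\<not> E x w"
      using p by (auto simp: pent_def)
    have xV: "x \<in> V - T" "y \<in> V - T" "z \<in> V - T" "w \<in> V - T" "u \<in> V - T" using CV xC by auto
    \<comment> \<open>Removing this triangle leaves the path \<open>y\<close>, \<open>x\<close>,
      \<open>u\<close> of \<open>C\<close>, which must extend to a pentagon of the new
      decomposition; \<open>r\<close> and \<open>s\<close> below are its other two vertices.\<close>
    define T2 where "T2 = {t, z, w}"
    have T2: "T2 \<subseteq> V" "pairwise_adj T2" "card T2 = 3"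
    proof -
      have "t \<noteq> z" "t \<noteq> w" using xV tt by blast+
      then show "card T2 = 3" using pd(1) by (simp add: T2_def)
    qed (use xV tt Tc(1) tz pd com in \<open>auto simp: T2_def pairwise_adj_def\<close>)
    obtain \<D> where \<D>: "pentagon_decomp (V - T2) (c - 1) \<D>" using tri[OF T2] by blast
    have xV2: "x \<in> V - T2" "y \<in> V - T2" "u \<in> V - T2" using xV pd(1) tt(1) by (auto simp: T2_def)
    then obtain D where D: "D \<in> \<D>" "x \<in> D" using \<D> unfolding pentagon_decomp_def by blast
    have yD: "y \<in> D" "u \<in> D" using pentagon_decomp_same[OF \<D> xV2(1) _ _ D] xV2 pd com by blast+
    have "card D \<noteq> 1" using D yD pd(1) by (auto simp: card_1_singleton_iff)
    then have "pentagon D" using \<D> D(1) by (auto simp: pentagon_decomp_def)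
    then obtain p1 p2 p3 p4 where DD: "D = {x, p1, p2, p3, p4}" and pD: "pent x p1 p2 p3 p4"
      using pentagon_at D(2) by blast
    have "y \<in> {p1, p4}" "u \<in> {p1, p4}" using yD pd pD com[of u x] unfolding DD pent_def by auto
    then have pq: "\<exists>r s. {r, s} \<subseteq> D \<and> {r, s} \<inter> {x, y, u} = {} \<and> r \<noteq> s \<and> E y r \<and> E u s \<and> \<not> E r x \<and> \<not> E s x"
    proof (cases "y = p1")
      case True
      then have "u = p4" using \<open>u \<in> {p1, p4}\<close> pd(1) by auto
      then show ?thesis using True pD com unfolding DD pent_def
        by (intro exI[of _ p2] exI[of _ p3]) auto
    next
      case False
      then have "y = p4" "u = p1" using \<open>y \<in> {p1, p4}\<close> \<open>u \<in> {p1, p4}\<close> pd(1) by auto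
      then show ?thesis using pD com unfolding DD pent_def
        by (intro exI[of _ p3] exI[of _ p2]) auto
    qed
    then obtain r s where rs: "r \<in> D" "s \<in> D" "r \<notin> {x, y, u}" "s \<notin> {x, y, u}" "r \<noteq> s"
      "E y r" "E u s" "\<not> E r x" "\<not> E s x" by auto
    have DV: "D \<subseteq> V - T2" using \<D> D(1) unfolding pentagon_decomp_def by blast
    \<comment> \<open>In \<open>V - T\<close> all neighbours of \<open>y\<close> lie in
      \<open>C\<close>, of which only \<open>x\<close>, \<open>y\<close>, \<open>u\<close> remain
      after removing \<open>T2\<close>; so \<open>r\<close>, and likewise \<open>s\<close>, comes
      from \<open>T\<close>. Hence \<open>t'\<close> is one of them and not adjacent to
      \<open>x\<close>. By \<open>cov'\<close> it is adjacent to \<open>z\<close> and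
      \<open>w\<close>, which makes \<open>{t, t', z, w}\<close> a forbidden clique.\<close>
    have rT: "r \<in> T"
    proof (rule ccontr)
      assume "r \<notin> T"
      then have "r \<in> C" using pentagon_decomp_same[OF dec xV(2) _ rs(6) C(1)] DV rs(1) xC by blast
      then show False using DV rs(1,3) xC by (auto simp: T2_def)
    qed
    have sT: "s \<in> T"
    proof (rule ccontr)
      assume "s \<notin> T"
      then have "s \<in> C" using pentagon_decomp_same[OF dec xV(5) _ rs(7) C(1)] DV rs(2) xC by blast
      then show False using DV rs(2,4) xC by (auto simp: T2_def)
    qed
    have "r \<noteq> t" "s \<noteq> t" using DV rs(1,2) by (auto simp: T2_def)
    then have "t' = r \<or> t' = s" using rT sT rs(5) T' by auto
    then have "\<not> E t' x" using rs(8,9) by blast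
    then have "E t' z" "E t' w" using cov'[of x z] cov'[of x w] pd xC by auto
    then have "pairwise_adj {t, t', z, w}" using Ett tz pd com by (auto simp: pairwise_adj_def)
    moreover have "t \<notin> {z, w}" "t' \<notin> {z, w}" using tt xV by blast+
    then have "card {t, t', z, w} = 4" using tt(3) pd(1) by simp
    moreover have "{t, t', z, w} \<subseteq> V" using tt xV Tc(1) by auto
    ultimately show False using no4 by blast
  qed
qed

text \<open>A vertex that is not critical could be deleted without changing \<open>k\<close> and
  \<open>c\<close>, and equality for the rest would give \<open>card V = k + 2 * c + 1\<close>. So
  every vertex is critical, as Gallai's lemma requires.\<close>

theorem extremal_structure: "extremal_hyp V k c \<Longrightarrow> extremal V k c"
proof (induction "card V" arbitrary: V k c rule: less_induct)
  case less
  have fin: "finite V" and n: "card V \<le> k + 2 * c" using less.prems by (auto simp: extremal_hyp_def)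
  have tf: "triangle_free V" by (rule extremal_no_triangle[OF less.prems less.hyps])
  have "\<exists>m<k. ccol (V - {v}) m" if v: "v \<in> V" for v
  proof (rule ccontr)
    assume no: "\<not> ?thesis"
    have "extremal_hyp (V - {v}) k c"
      unfolding extremal_hyp_def
    proof (intro conjI allI impI)
      fix m assume "ccol (V - {v}) m"
      then show "k \<le> m" using no by (metis not_le)
    next
      fix S assume "S \<subseteq> V - {v}" "stable S"
      then show "card S + c \<le> k" using less.prems unfolding extremal_hyp_def by blast
    qed (use less.prems v in \<open>auto simp: extremal_hyp_def\<close>)
    moreover have "Suc (card (V - {v})) = card V" using card.remove[OF fin v] by simp
    ultimately have "card (V - {v}) = k + 2 * c" using less.hyps by (auto simp: extremal_def)
    then show False using n \<open>Suc (card (V - {v})) = card V\<close> by simp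
  qed
  then show ?case unfolding extremal_def by (rule extremal_triangle_free_critical[OF less.prems tf])
qed

end

subsection \<open>Homomorphisms and clique bounds\<close>

text \<open>Arrowing is preserved along homomorphisms, so a homomorphism into the extremal graph suffices where
  one would expect an isomorphism; homomorphisms into complete graphs are proper colourings.\<close>

definition hom :: "('a \<Rightarrow> 'b) \<Rightarrow> 'a ugraph \<Rightarrow> 'b ugraph \<Rightarrow> bool" where
  "hom f G H \<longleftrightarrow> f ` verts G \<subseteq> verts H \<and>
     (\<forall>u\<in>verts G. \<forall>v\<in>verts G. u \<noteq> v \<longrightarrow> {u, v} \<in> edges G \<longrightarrow> f u \<noteq> f v \<and> {f u, f v} \<in> edges H)"

text \<open>The partition of the edges of \<open>H\<close> is pulled back along \<open>f\<close>; a
  clique is mapped injectively because adjacent vertices have distinct images.\<close>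

lemma edge_arrows_hom:
  assumes G: "simple_graph G" and f: "hom f G H" and arr: "G \<rightarrow>\<^sub>e as"
  shows "H \<rightarrow>\<^sub>e as"
  unfolding edge_arrows_def
proof (intro allI impI, elim conjE)
  fix P :: "nat \<Rightarrow> 'b set set"
  assume U: "(\<Union>i<length as. P i) = edges H" and dj: "disjoint_family_on P {..<length as}"
  define P' where "P' i = {e\<in>edges G. f ` e \<in> P i}" for i
  have fe: "f ` e \<in> edges H" if "e \<in> edges G" for e
  proof -
    have "e \<in> [verts G]\<^bsup>2\<^esup>" using that G by (auto simp: simple_graph_def)
    then obtain u v where "e = {u, v}" "u \<noteq> v" "u \<in> verts G" "v \<in> verts G" by (auto elim: nsets2_E)
    then show ?thesis using f that by (auto simp: hom_def)
  qed
  have "(\<Union>i<length as. P' i) = edges G" using fe U by (auto simp: P'_def)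
  moreover have "disjoint_family_on P' {..<length as}"
    using dj by (auto simp: disjoint_family_on_def P'_def)
  ultimately obtain i S where i: "i < length as" and S: "S \<subseteq> verts G" "card S = as ! i" "clique S (P' i)"
    using arr unfolding edge_arrows_def by meson
  have e: "f u \<noteq> f v" "{f u, f v} \<in> P i" if uv: "u \<in> S" "v \<in> S" "u \<noteq> v" for u v
  proof -
    have "{u, v} \<in> P' i" using S(3) uv by (auto simp: clique_def)
    then have "{u, v} \<in> edges G" "f ` {u, v} \<in> P i" by (auto simp: P'_def)
    then show "f u \<noteq> f v" "{f u, f v} \<in> P i" using f uv S(1) by (auto simp: hom_def)
  qed
  have "inj_on f S" using e(1) by (meson inj_onI)
  then have "card (f ` S) = as ! i" using S(2) by (simp add: card_image)
  moreover have "clique (f ` S) (P i)" unfolding clique_def using e(2) by (metis imageE)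
  moreover have "f ` S \<subseteq> verts H" using S(1) f by (auto simp: hom_def)
  ultimately show "\<exists>i<length as. \<exists>S\<subseteq>verts H. card S = as ! i \<and> clique S (P i)" using i by blast
qed

definition clique_bound :: "'a ugraph \<Rightarrow> nat \<Rightarrow> bool" where
  "clique_bound G n \<longleftrightarrow> (\<forall>S\<subseteq>verts G. clique S (edges G) \<longrightarrow> card S \<le> n)"

lemma clique_number_le_iff:
  assumes "simple_graph G" shows "clique_number G \<le> n \<longleftrightarrow> clique_bound G n"
proof -
  let ?A = "{card S |S. S \<subseteq> verts G \<and> clique S (edges G)}"
  have "?A \<subseteq> card ` Pow (verts G)" by auto
  then have "finite ?A" by (rule finite_subset) (use assms in \<open>simp add: simple_graph_def\<close>)
  moreover have "card ({}::'a set) \<in> ?A" by (auto simp: clique_def intro!: exI[of _ "{}"])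
  then have "?A \<noteq> {}" by blast
  ultimately show ?thesis unfolding clique_number_def clique_bound_def by (subst Max_le_iff) auto
qed

lemma clique_bound_complete: "clique_bound (complete_graph n) n"
  unfolding clique_bound_def complete_graph_def using card_mono[of "{..<n}"] by auto

lemma inj_image_image: "inj f \<Longrightarrow> f ` e \<in> (`) f ` A \<longleftrightarrow> e \<in> A"
  by (rule inj_image_mem_iff) (simp add: inj_def inj_image_eq_iff)

lemma join_edge_Inl: "{Inl u, Inl v} \<in> edges (G \<oplus>\<^sub>g H) \<longleftrightarrow> {u, v} \<in> edges G"
proof -
  have "{Inl u, Inl v} \<notin> (`) Inr ` edges H" by (metis Inl_Inr_False imageE insertI1)
  moreover have "{Inl u, Inl v} \<in> (`) Inl ` edges G \<longleftrightarrow> {u, v} \<in> edges G"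
    using inj_image_image[OF inj_Inl, of "{u, v}"] by simp
  ultimately show ?thesis unfolding join_def by (auto simp: doubleton_eq_iff)
qed

lemma join_edge_Inr: "{Inr u, Inr v} \<in> edges (G \<oplus>\<^sub>g H) \<longleftrightarrow> {u, v} \<in> edges H"
proof -
  have "{Inr u, Inr v} \<notin> (`) Inl ` edges G" by (metis Inl_Inr_False imageE insertI1)
  moreover have "{Inr u, Inr v} \<in> (`) Inr ` edges H \<longleftrightarrow> {u, v} \<in> edges H"
    using inj_image_image[OF inj_Inr, of "{u, v}"] by simp
  ultimately show ?thesis unfolding join_def by (auto simp: doubleton_eq_iff)
qed

lemma clique_bound_join:
  assumes "simple_graph G" "simple_graph H" "clique_bound G m" "clique_bound H n"
  shows "clique_bound (G \<oplus>\<^sub>g H) (m + n)"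
  unfolding clique_bound_def
proof (intro allI impI)
  fix S assume S: "S \<subseteq> verts (G \<oplus>\<^sub>g H)" and cl: "clique S (edges (G \<oplus>\<^sub>g H))"
  define A where "A = {u. Inl u \<in> S}"
  define B where "B = {v. Inr v \<in> S}"
  have AB: "A \<subseteq> verts G" "B \<subseteq> verts H" using S by (auto simp: A_def B_def join_def)
  have fin: "finite A" "finite B" using AB assms(1,2) finite_subset by (auto simp: simple_graph_def)
  have SU: "S = Inl ` A \<union> Inr ` B"
  proof (rule set_eqI)
    show "x \<in> S \<longleftrightarrow> x \<in> Inl ` A \<union> Inr ` B" for x by (cases x) (auto simp: A_def B_def)
  qed
  have "clique A (edges G)"
    unfolding clique_def
  proof (intro ballI impI)
    fix u v assume "u \<in> A" "v \<in> A" "u \<noteq> v"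
    then have "{Inl u, Inl v} \<in> edges (G \<oplus>\<^sub>g H)" using cl by (auto simp: clique_def A_def)
    then show "{u, v} \<in> edges G" by (simp only: join_edge_Inl)
  qed
  moreover have "clique B (edges H)"
    unfolding clique_def
  proof (intro ballI impI)
    fix u v assume "u \<in> B" "v \<in> B" "u \<noteq> v"
    then have "{Inr u, Inr v} \<in> edges (G \<oplus>\<^sub>g H)" using cl by (auto simp: clique_def B_def)
    then show "{u, v} \<in> edges H" by (simp only: join_edge_Inr)
  qed
  ultimately have "card A \<le> m" "card B \<le> n" using assms(3,4) AB by (auto simp: clique_bound_def)
  moreover have "card S = card A + card B"
    unfolding SU using fin by (subst card_Un_disjoint) (auto simp: card_image)
  ultimately show "card S \<le> m + n" by simp
qed

section \<open>Clique numbers of the 5-cycle and of \<open>Q\<close>\<close>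

lemma clique_bound_cycle5: "clique_bound cycle5 2"
  unfolding clique_bound_def
proof (intro allI impI, rule ccontr)
  fix S assume S: "S \<subseteq> verts cycle5" "clique S (edges cycle5)" "\<not> card S \<le> 2"
  then have "3 \<le> card S" by simp
  then obtain T where "T \<subseteq> S" "card T = 3" by (meson obtain_subset_with_card_n)
  then obtain p q r where p: "p \<in> S" "q \<in> S" "r \<in> S" "p \<noteq> q" "p \<noteq> r" "q \<noteq> r"
    by (auto simp: card_3_iff)
  have e: "v = u + 1 \<or> u = v + 1 \<or> u = 4 \<and> v = 0 \<or> u = 0 \<and> v = 4" if uv: "u \<in> S" "v \<in> S" "u \<noteq> v" for u v
  proof -
    have m: "(i + 1) mod 5 = (if i = 4 then 0 else i + 1)" if "i < 5" for i :: nat using that by auto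
    have "{u, v} \<in> edges cycle5" using S(2) uv by (simp add: clique_def)
    then obtain i where "{u, v} = {i, (i + 1) mod 5}" "i < 5" unfolding cycle5_def by auto
    then have "{u, v} = {i, if i = 4 then 0 else i + 1}" by (simp only: m)
    then show ?thesis by (auto simp: doubleton_eq_iff split: if_splits)
  qed
  show False using e[OF p(1,2,4)] e[OF p(1,3,5)] e[OF p(2,3,6)] p(4-6) by linarith
qed

text \<open>\<open>D\<close> is 1 to 12 without 1, 5, 8, 12, the residues of 1, 5, -5, -1. Listing a
  clique in increasing order makes all differences positive and avoids modular arithmetic; the
  nesting prunes the search by evaluation after each vertex.\<close>

lemma circulant_no_5:
  "list_all (\<lambda>a. list_all (\<lambda>b. (b - a) \<in> set D \<longrightarrow>
     list_all (\<lambda>c. (c - a) \<in> set D \<and> (c - b) \<in> set D \<longrightarrow>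
     list_all (\<lambda>d. (d - a) \<in> set D \<and> (d - b) \<in> set D \<and> (d - c) \<in> set D \<longrightarrow>
     list_all (\<lambda>e. \<not> ((e - a) \<in> set D \<and> (e - b) \<in> set D \<and> (e - c) \<in> set D \<and> (e - d) \<in> set D)) [0..12])
     [0..12]) [0..12]) [0..12]) [0..12]" if "D = [2,3,4,6,7,9,10,11::int]"
  unfolding that by code_simp

lemma clique_bound_graph_Q: "clique_bound graph_Q 4"
  unfolding clique_bound_def
proof (intro allI impI, rule ccontr)
  fix S assume S: "S \<subseteq> verts graph_Q" "clique S (edges graph_Q)" "\<not> card S \<le> 4"
  have fin: "finite S" using S(3) card.infinite by fastforce
  have 5: "5 \<le> card S" using S(3) by simp
  define xs where "xs = sorted_list_of_set S"
  have xs: "set xs = S" "sorted_wrt (<) xs" "length xs = card S" using fin by (simp_all add: xs_def)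
  have lt: "xs ! i < xs ! j" if "i < j" "j < 5" for i j
    using sorted_wrt_nth_less[OF xs(2)] that xs(3) 5 by simp
  have mem: "xs ! i \<in> S" if "i < 5" for i using that xs 5 by (metis less_le_trans nth_mem)
  define D where "D = [2,3,4,6,7,9,10,11::int]"
  have diff: "v - u \<in> set D" if uv: "u \<in> S" "v \<in> S" "u < v" for u v
  proof -
    have r: "0 \<le> u" "u < 13" "0 \<le> v" "v < 13" using uv S(1) by (auto simp: graph_Q_def)
    have "{v, u} \<in> edges graph_Q" using S(2) uv by (auto simp: clique_def)
    have diffs: "\<not> [v - u = c] (mod 13)" if "c \<in> {1, -1, 5, -5}" for c
    proof -
      obtain i j where ij: "{v, u} = {i, j}" "\<forall>c\<in>{1, -1, 5, -5}. \<not> [i - j = c] (mod 13)"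
        using \<open>{v, u} \<in> edges graph_Q\<close> by (auto simp: graph_Q_def)
      then consider "v = i" "u = j" | "v = j" "u = i" by (auto simp: doubleton_eq_iff)
      then show ?thesis
      proof cases
        case 1 then show ?thesis using ij(2) that by blast
      next
        case 2
        have "- c \<in> {1, -1, 5, -5}" using that by auto
        then have "\<not> [u - v = - c] (mod 13)" using ij(2) 2 by blast
        then show ?thesis using cong_minus_minus_iff[of "v - u" c 13] by simp
      qed
    qed
    have "v - u \<noteq> 1" "v - u \<noteq> 5" "v - u \<noteq> 8" "v - u \<noteq> 12"
      using diffs[of 1] diffs[of 5] diffs[of "-5"] diffs[of "-1"] by (auto simp: cong_def)
    moreover have "1 \<le> v - u" "v - u \<le> 12" using r uv(3) by linarith+
    ultimately show ?thesis unfolding D_def by (simp, presburger)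
  qed
  have in12: "xs ! i \<in> set [0..12]" if "i < 5" for i
    using mem[OF that] S(1) by (auto simp: graph_Q_def)
  have dd: "xs ! j - xs ! i \<in> set D" if "i < j" "j < 5" for i j
    using diff[OF mem mem lt] that by simp
  have i: "xs ! 0 \<in> set [0..12]" "xs ! 1 \<in> set [0..12]" "xs ! 2 \<in> set [0..12]" "xs ! 3 \<in> set [0..12]"
    "xs ! 4 \<in> set [0..12]" by (rule in12, simp)+
  have d: "xs ! 1 - xs ! 0 \<in> set D" "xs ! 2 - xs ! 0 \<in> set D \<and> xs ! 2 - xs ! 1 \<in> set D"
    "xs ! 3 - xs ! 0 \<in> set D \<and> xs ! 3 - xs ! 1 \<in> set D \<and> xs ! 3 - xs ! 2 \<in> set D"
    "xs ! 4 - xs ! 0 \<in> set D \<and> xs ! 4 - xs ! 1 \<in> set D \<and> xs ! 4 - xs ! 2 \<in> set D \<and> xs ! 4 - xs ! 3 \<in> set D"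
    by (intro conjI dd; simp)+
  note L = circulant_no_5[OF D_def, unfolded list_all_iff]
  note L1 = L[THEN bspec, OF i(1), THEN bspec, OF i(2), THEN mp, OF d(1)]
  note L2 = L1[THEN bspec, OF i(3), THEN mp, OF d(2)]
  note L3 = L2[THEN bspec, OF i(4), THEN mp, OF d(3), THEN bspec, OF i(5)]
  show False using L3 d(4) by (rule notE)
qed

lemma mod_eq_of_cong_diff:
  assumes "i < n" "[int i - int j = int c] (mod int n)" shows "i = (j + c) mod n"
proof -
  have "[int i = int (j + c)] (mod int n)" using assms(2) by (simp add: cong_iff_dvd_diff algebra_simps)
  then show ?thesis using assms(1) by (simp only: cong_int_iff) (simp add: cong_def)
qed

text \<open>\<open>folkman_number\<close> ranges over graphs on \<open>nat\<close>, whereas the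
  joins live on sum types.\<close>

lemma nat_copy:
  fixes H :: "'b::countable ugraph"
  assumes "simple_graph H" "clique_bound H n"
  shows "\<exists>G :: nat ugraph. simple_graph G \<and> card (verts G) = card (verts H) \<and> clique_bound G n \<and> hom to_nat H G"
proof (intro exI conjI)
  let ?G = "(to_nat ` verts H, (`) to_nat ` edges H)"
  have e: "{to_nat u, to_nat v} \<in> edges ?G \<longleftrightarrow> {u, v} \<in> edges H" for u v :: 'b
  proof -
    have "to_nat ` {u, v} \<in> (`) to_nat ` edges H \<longleftrightarrow> {u, v} \<in> edges H" by (rule inj_image_image) simp
    then show ?thesis by simp
  qed
  show "simple_graph ?G"
    unfolding simple_graph_def
  proof (intro conjI subsetI)
    show "finite (verts ?G)" using assms(1) by (simp add: simple_graph_def)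
    fix e' assume "e' \<in> edges ?G"
    then obtain e where "e \<in> edges H" "e' = to_nat ` e" by auto
    moreover from this have "e \<in> [verts H]\<^bsup>2\<^esup>" using assms(1) by (auto simp: simple_graph_def)
    ultimately show "e' \<in> [verts ?G]\<^bsup>2\<^esup>" by (auto elim!: nsets2_E)
  qed
  show "card (verts ?G) = card (verts H)" by (simp add: card_image)
  show "hom to_nat H ?G" unfolding hom_def using e by simp
  show "clique_bound ?G n"
    unfolding clique_bound_def
  proof (intro allI impI)
    fix S assume S: "S \<subseteq> verts ?G" "clique S (edges ?G)"
    define T where "T = {v\<in>verts H. to_nat v \<in> S}"
    have ST: "S = to_nat ` T" using S(1) by (auto simp: T_def)
    have "clique T (edges H)" using S(2) e unfolding ST clique_def by (metis imageI inj_eq inj_to_nat)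
    then have "card T \<le> n" using assms(2) by (auto simp: clique_bound_def T_def)
    then show "card S \<le> n" unfolding ST by (simp add: card_image)
  qed
qed

definition nonadj :: "'a ugraph \<Rightarrow> 'a \<Rightarrow> 'a \<Rightarrow> bool" where
  "nonadj G u v \<longleftrightarrow> u \<noteq> v \<and> {u, v} \<notin> edges G"

lemma nonadjacency_nonadj: "nonadjacency (nonadj G)"
  by unfold_locales (auto simp: nonadj_def insert_commute)

context nonadjacency begin

text \<open>The counterpart of \<open>hom\<close> for the graph on \<open>A\<close> in which the
  pairs outside \<open>E\<close> are adjacent; it applies to subsets without naming the induced
  subgraph.\<close>

definition nhom :: "('a \<Rightarrow> 'b) \<Rightarrow> 'a set \<Rightarrow> 'b ugraph \<Rightarrow> bool" where
  "nhom f A H \<longleftrightarrow> f ` A \<subseteq> verts H \<and>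
     (\<forall>u\<in>A. \<forall>v\<in>A. u \<noteq> v \<longrightarrow> \<not> E u v \<longrightarrow> f u \<noteq> f v \<and> {f u, f v} \<in> edges H)"

text \<open>No condition on pairs between \<open>A\<close> and \<open>B\<close> is needed, because
  the join contains all edges across.\<close>

lemma nhom_join:
  assumes "nhom f A G" "nhom g B H" "A \<inter> B = {}"
  shows "nhom (\<lambda>x. if x \<in> A then Inl (f x) else Inr (g x)) (A \<union> B) (G \<oplus>\<^sub>g H)"
  unfolding nhom_def
proof (intro conjI ballI impI)
  let ?h = "\<lambda>x. if x \<in> A then Inl (f x) else Inr (g x)"
  show "?h ` (A \<union> B) \<subseteq> verts (G \<oplus>\<^sub>g H)" using assms by (auto simp: nhom_def join_def)
  fix u v assume uv: "u \<in> A \<union> B" "v \<in> A \<union> B" "u \<noteq> v" "\<not> E u v"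
  consider "u \<in> A" "v \<in> A" | "u \<in> A" "v \<in> B" "v \<notin> A" | "u \<in> B" "u \<notin> A" "v \<in> A" | "u \<in> B" "v \<in> B" "u \<notin> A" "v \<notin> A"
    using uv by blast
  then have "?h u \<noteq> ?h v \<and> {?h u, ?h v} \<in> edges (G \<oplus>\<^sub>g H)"
  proof cases
    case 1
    then have "f u \<noteq> f v" "{f u, f v} \<in> edges G" using assms(1) uv by (auto simp: nhom_def)
    then show ?thesis using 1 by (simp add: join_edge_Inl)
  next
    case 2
    then have "f u \<in> verts G" "g v \<in> verts H" using assms by (auto simp: nhom_def)
    then show ?thesis using 2 by (auto simp: join_def)
  next
    case 3
    then have "f v \<in> verts G" "g u \<in> verts H" using assms by (auto simp: nhom_def)
    then have "{Inl (f v), Inr (g u)} \<in> edges (G \<oplus>\<^sub>g H)" by (auto simp: join_def)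
    then show ?thesis using 3 by (simp add: insert_commute)
  next
    case 4
    then have "g u \<noteq> g v" "{g u, g v} \<in> edges H" using assms(2) uv by (auto simp: nhom_def)
    then show ?thesis using 4 by (simp add: join_edge_Inr)
  qed
  then show "?h u \<noteq> ?h v" "{?h u, ?h v} \<in> edges (G \<oplus>\<^sub>g H)" by blast+
qed

lemma nhom_complete:
  assumes "finite A" shows "\<exists>f. nhom f A (complete_graph (card A))"
proof -
  from assms obtain f where "bij_betw f A {0..<card A}" using ex_bij_betw_finite_nat by blast
  then have "nhom f A (complete_graph (card A))"
    unfolding nhom_def complete_graph_def bij_betw_def inj_on_def by auto
  then show ?thesis by blast
qed

lemma nhom_ccol: "ccol A m \<Longrightarrow> \<exists>f. nhom f A (complete_graph m)"
  unfolding ccol_def nhom_def complete_graph_def by (elim exE, rule_tac x = f in exI) auto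

lemma nhom_pentagon:
  assumes "pentagon K" shows "\<exists>f. nhom f K cycle5"
proof -
  obtain x y z w u where K: "K = {x, y, z, w, u}" and p: "pent x y z w u" using assms by (rule pentagonE)
  \<comment> \<open>The complement of a pentagon is again a pentagon, traversed in the order
    \<open>x\<close>, \<open>z\<close>, \<open>u\<close>, \<open>y\<close>,
    \<open>w\<close>.\<close>
  define f where "f = (\<lambda>v. if v = x then 0 else if v = z then 1 else if v = u then 2 else if v = y then 3 else (4::nat))"
  have f: "f x = 0" "f z = 1" "f u = 2" "f y = 3" "f w = 4" using p by (auto simp: f_def pent_def)
  have "edges cycle5 = {{0, 1}, {1, 2}, {2, 3}, {3, 4}, {4, 0}}"
  proof -
    have "{..<5} = {0, 1, 2, 3, 4::nat}" by auto
    moreover have "edges cycle5 = (\<lambda>i. {i, (i + 1) mod 5}) ` {..<5}" by (auto simp: cycle5_def)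
    ultimately show ?thesis by (simp add: numeral_2_eq_2)
  qed
  then have "nhom f K cycle5" unfolding nhom_def K using p sym
    by (auto simp: f pent_def cycle5_def[THEN arg_cong, of fst] insert_commute)
  then show ?thesis by blast
qed

lemma nhom_circ13:
  assumes "circ13 W" shows "\<exists>f. nhom f W graph_Q"
proof -
  obtain vs where l: "length vs = 13" and d: "distinct vs" and s: "set vs = W"
    and e: "\<And>i. i < 13 \<Longrightarrow> E (vs ! i) (vs ! ((i + 1) mod 13))" "\<And>i. i < 13 \<Longrightarrow> E (vs ! i) (vs ! ((i + 5) mod 13))"
    using assms unfolding circ13_def by blast
  define f where "f v = int (THE i. i < 13 \<and> vs ! i = v)" for v
  have f: "f (vs ! i) = int i" if "i < 13" for i
  proof -
    have "(THE j. j < 13 \<and> vs ! j = vs ! i) = i"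
      using that d l by (intro the_equality) (auto simp: nth_eq_iff_index_eq)
    then show ?thesis by (simp add: f_def)
  qed
  have idx: "\<exists>i<13. v = vs ! i" if "v \<in> W" for v using that s l by (metis in_set_conv_nth)
  have "f u \<noteq> f v \<and> {f u, f v} \<in> edges graph_Q" if uv: "u \<in> W" "v \<in> W" "u \<noteq> v" "\<not> E u v" for u v
  proof -
    obtain i j where ij: "i < 13" "u = vs ! i" "j < 13" "v = vs ! j" using idx uv by metis
    have ne: "i \<noteq> j" using uv ij by blast
    have 1: "j \<noteq> (i + 1) mod 13" "j \<noteq> (i + 5) mod 13" "i \<noteq> (j + 1) mod 13" "i \<noteq> (j + 5) mod 13"
      using e[of i] e[of j] ij uv(4) sym by blast+
    have "\<not> [int i - int j = c] (mod 13)" if "c \<in> {1, -1, 5, -5}" for c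
    proof
      assume c: "[int i - int j = c] (mod 13)"
      then have c': "[int j - int i = - c] (mod 13)" using cong_minus_minus_iff[of "int i - int j" c 13] by simp
      from that consider "c = 1" | "c = -1" | "c = 5" | "c = -5" by blast
      then show False
        using mod_eq_of_cong_diff[OF ij(1), of j 1] mod_eq_of_cong_diff[OF ij(1), of j 5]
          mod_eq_of_cong_diff[OF ij(3), of i 1] mod_eq_of_cong_diff[OF ij(3), of i 5] c c' 1
        by cases simp_all
    qed
    then have "\<forall>c\<in>{1, -1, 5, -5}. \<not> [int i - int j = c] (mod 13)" by blast
    moreover have "int i \<in> {0..<13}" "int j \<in> {0..<13}" "int i \<noteq> int j" using ij(1,3) ne by auto
    ultimately have "{int i, int j} \<in> edges graph_Q" unfolding graph_Q_def snd_conv by blast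
    then show ?thesis using f ij ne by simp
  qed
  moreover have "f ` W \<subseteq> verts graph_Q" using idx f by (fastforce simp: graph_Q_def)
  ultimately have "nhom f W graph_Q" unfolding nhom_def by blast
  then show ?thesis by blast
qed

lemma card_circ13: "circ13 W \<Longrightarrow> card W = 13"
  unfolding circ13_def using distinct_card by metis

text \<open>The complete part receives the \<open>k + 6 - 13 = k - 7\<close> vertices outside
  \<open>W\<close>. Three pentagons leave \<open>k + 6 - 15 = k - 9\<close> in the other
  case.\<close>

lemma nhom_of_padded_circ13:
  assumes "padded_circ13 V" "finite V" "card V = k + 6"
  shows "7 \<le> k \<and> (\<exists>f. nhom f V (complete_graph (k - 7) \<oplus>\<^sub>g graph_Q))"
proof -
  obtain W where W: "W \<subseteq> V" "circ13 W" using assms(1) by (auto simp: padded_circ13_def)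
  have "card V = card (V - W) + 13" using W assms(2) card_circ13[OF W(2)]
    by (metis card_Diff_subset card_mono finite_subset le_add_diff_inverse2)
  then have c: "7 \<le> k" "card (V - W) = k - 7" using assms(3) by linarith+
  obtain f g where "nhom f (V - W) (complete_graph (k - 7))" "nhom g W graph_Q"
    using nhom_complete[of "V - W"] nhom_circ13[OF W(2)] assms(2) c by auto
  from nhom_join[OF this] have "\<exists>f. nhom f ((V - W) \<union> W) (complete_graph (k - 7) \<oplus>\<^sub>g graph_Q)" by blast
  moreover have "(V - W) \<union> W = V" using W by blast
  ultimately show ?thesis using c by simp
qed

lemma nhom_of_pentagon_decomp_3:
  assumes dec: "pentagon_decomp V 3 \<C>" and fin: "finite V" and cV: "card V = k + 6"
  shows "9 \<le> k \<and> (\<exists>f. nhom f V (complete_graph (k - 9) \<oplus>\<^sub>g cycle5 \<oplus>\<^sub>g cycle5 \<oplus>\<^sub>g cycle5))"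
proof -
  have U: "\<Union>\<C> = V" and d: "disjoint \<C>" and c: "card {C\<in>\<C>. pentagon C} = 3" using dec by (auto simp: pentagon_decomp_def)
  from c obtain A B C where ABC: "{C\<in>\<C>. pentagon C} = {A, B, C}" "A \<noteq> B" "B \<noteq> C" "A \<noteq> C"
    by (auto simp: card_3_iff)
  then have p: "pentagon A" "pentagon B" "pentagon C" and mem: "A \<in> \<C>" "B \<in> \<C>" "C \<in> \<C>" by blast+
  have dj: "A \<inter> B = {}" "B \<inter> C = {}" "A \<inter> C = {}" using d mem ABC(2-4) by (auto simp: disjoint_def)
  let ?W = "A \<union> (B \<union> C)"
  have W: "?W \<subseteq> V" using mem U by blast
  have finABC: "finite A" "finite B" "finite C" using W fin finite_subset by (metis le_supE)+
  have "card ?W = 15" using dj finABC p[THEN card_pentagon] by (subst card_Un_disjoint; (subst card_Un_disjoint)?; auto)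
  then have "card V = card (V - ?W) + 15" using W fin
    by (metis card_Diff_subset card_mono finite_subset le_add_diff_inverse2)
  then have k: "9 \<le> k" "card (V - ?W) = k - 9" using cV by linarith+
  obtain h where h: "nhom h (V - ?W) (complete_graph (k - 9))" using nhom_complete[of "V - ?W"] fin k by auto
  obtain f1 f2 f3 where f: "nhom f1 A cycle5" "nhom f2 B cycle5" "nhom f3 C cycle5"
    using p[THEN nhom_pentagon] by blast
  have "\<exists>f. nhom f (B \<union> C) (cycle5 \<oplus>\<^sub>g cycle5)" using nhom_join[OF f(2,3) dj(2)] by blast
  then obtain g where g: "nhom g (B \<union> C) (cycle5 \<oplus>\<^sub>g cycle5)" by blast
  have "A \<inter> (B \<union> C) = {}" using dj by blast
  then have "\<exists>f. nhom f ?W (cycle5 \<oplus>\<^sub>g cycle5 \<oplus>\<^sub>g cycle5)" using nhom_join[OF f(1) g] by blast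
  then obtain g' where g': "nhom g' ?W (cycle5 \<oplus>\<^sub>g cycle5 \<oplus>\<^sub>g cycle5)" by blast
  have "\<exists>f. nhom f ((V - ?W) \<union> ?W) (complete_graph (k - 9) \<oplus>\<^sub>g cycle5 \<oplus>\<^sub>g cycle5 \<oplus>\<^sub>g cycle5)"
    using nhom_join[OF h g'] by blast
  moreover have "(V - ?W) \<union> ?W = V" using W by blast
  ultimately show ?thesis using k by simp
qed

end

text \<open>A colouring of \<open>G\<close> with \<open>m\<close> colours makes the complete graph
  on \<open>m\<close> vertices arrow, so \<open>R \<le> m\<close>. Assuming only an upper bound on
  the number of vertices lets this serve both as the lower bound for the Folkman number and as the
  description of equality.\<close>

lemma folkman_graph_structure:
  fixes G :: "'a ugraph"
  assumes G: "simple_graph G" and arr: "G \<rightarrow>\<^sub>e as" and cl: "clique_number G < R - 2"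
    and R: "R = ramsey_number as" and n: "card (verts G) \<le> R + 6"
  shows "card (verts G) = R + 6 \<and>
    (R \<ge> 7 \<and> complete_graph (R - 7) \<oplus>\<^sub>g graph_Q \<rightarrow>\<^sub>e as \<or>
     R \<ge> 9 \<and> complete_graph (R - 9) \<oplus>\<^sub>g cycle5 \<oplus>\<^sub>g cycle5 \<oplus>\<^sub>g cycle5 \<rightarrow>\<^sub>e as)"
proof -
  interpret nonadjacency "nonadj G" by (rule nonadjacency_nonadj)
  have fin: "finite (verts G)" using G by (simp add: simple_graph_def)
  have "clique_number G \<le> R - 3" using cl by linarith
  then have cb: "clique_bound G (R - 3)" using clique_number_le_iff[OF G] by blast
  have "extremal_hyp (verts G) R 3"
    unfolding extremal_hyp_def
  proof (intro conjI allI impI)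
    fix m assume "ccol (verts G) m"
    then obtain f where "nhom f (verts G) (complete_graph m)" using nhom_ccol by blast
    then show "R \<le> m" unfolding R ramsey_number_def by (intro Least_le edge_arrows_hom[OF G _ arr, of f])
        (auto simp: nhom_def hom_def nonadj_def)
  next
    fix S assume S: "S \<subseteq> verts G" "stable S"
    then have "clique S (edges G)" by (auto simp: stable_def clique_def nonadj_def)
    then have "card S \<le> R - 3" using cb S(1) by (simp add: clique_bound_def)
    \<comment> \<open>Truncated subtraction does no harm: \<open>clique_number G < R - 2\<close>
      forces \<open>R \<ge> 3\<close>.\<close>
    then show "card S + 3 \<le> R" using cl by linarith
  qed (use fin n in auto)
  then have ex: "extremal (verts G) R 3" by (rule extremal_structure)
  then have c: "card (verts G) = R + 6" by (simp add: extremal_def)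
  consider \<C> where "pentagon_decomp (verts G) 3 \<C>" | "padded_circ13 (verts G)" using ex by (auto simp: extremal_def)
  then show ?thesis
  proof cases
    case 1
    from nhom_of_pentagon_decomp_3[OF 1 fin c] obtain f where "R \<ge> 9"
      "nhom f (verts G) (complete_graph (R - 9) \<oplus>\<^sub>g cycle5 \<oplus>\<^sub>g cycle5 \<oplus>\<^sub>g cycle5)" by blast
    then show ?thesis using c edge_arrows_hom[OF G _ arr, of f]
      by (auto simp: nhom_def hom_def nonadj_def)
  next
    case 2
    from nhom_of_padded_circ13[OF 2 fin c] obtain f where "R \<ge> 7"
      "nhom f (verts G) (complete_graph (R - 7) \<oplus>\<^sub>g graph_Q)" by blast
    then show ?thesis using c edge_arrows_hom[OF G _ arr, of f]
      by (auto simp: nhom_def hom_def nonadj_def)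
  qed
qed

section \<open>Witnesses from the two families, and the equivalence\<close>

lemma folkman_witness:
  fixes H :: "'b::countable ugraph"
  assumes H: "simple_graph H" "clique_bound H (R - 3)" "H \<rightarrow>\<^sub>e as" "card (verts H) = R + 6" and R: "R \<ge> 3"
  shows "\<exists>G :: nat ugraph. simple_graph G \<and> G \<rightarrow>\<^sub>e as \<and> clique_number G < R - 2 \<and> card (verts G) = R + 6"
proof -
  obtain G :: "nat ugraph" where G: "simple_graph G" "card (verts G) = card (verts H)" "clique_bound G (R - 3)" "hom to_nat H G"
    using nat_copy[OF H(1,2)] by blast
  have "clique_number G \<le> R - 3" using G clique_number_le_iff by blast
  then have "clique_number G < R - 2" using R by linarith
  then show ?thesis using G H edge_arrows_hom by metis
qed

lemma card_verts_join:
  "simple_graph G \<Longrightarrow> simple_graph H \<Longrightarrow> card (verts (G \<oplus>\<^sub>g H)) = card (verts G) + card (verts H)"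
  by (simp add: join_def simple_graph_def card_Plus)

text \<open>A finite value excludes the empty set, whose infimum is infinite, and otherwise the
  infimum is a least element.\<close>

lemma Inf_enat_attained:
  assumes "Inf X = enat n" shows "enat n \<in> X"
proof -
  have "X \<noteq> {}" using assms by (auto simp: top_enat_def)
  then obtain x where "x \<in> X" by blast
  then have "(LEAST x. x \<in> X) \<in> X" by (rule LeastI)
  then show ?thesis using assms \<open>X \<noteq> {}\<close> by (simp add: Inf_enat_def)
qed

theorem theorem4p2:
  fixes as :: "nat list" and R :: nat
  assumes "length as \<ge> 2"
    and "\<forall>a\<in>set as. a \<ge> 3"
    and "R = ramsey_number as"
  shows "folkman_number as (R - 2) = enat (R + 6) \<longleftrightarrow>
           (R \<ge> 7 \<and> complete_graph (R - 7) \<oplus>\<^sub>g graph_Q \<rightarrow>\<^sub>e as) \<or>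
           (R \<ge> 9 \<and> complete_graph (R - 9) \<oplus>\<^sub>g cycle5 \<oplus>\<^sub>g cycle5 \<oplus>\<^sub>g cycle5 \<rightarrow>\<^sub>e as)"
    (is "?F = _ \<longleftrightarrow> ?A \<or> ?B")
proof
  let ?\<G> = "{G :: nat ugraph. simple_graph G \<and> G \<rightarrow>\<^sub>e as \<and> clique_number G < R - 2}"
  assume F: "?F = enat (R + 6)"
  let ?X = "(\<lambda>G. enat (card (verts G))) ` ?\<G>"
  have "Inf ?X = enat (R + 6)" using F by (simp add: folkman_number_def)
  then have "enat (R + 6) \<in> ?X" by (rule Inf_enat_attained)
  then obtain G where "G \<in> ?\<G>" "card (verts G) = R + 6" by auto
  then show "?A \<or> ?B" using folkman_graph_structure[of G as R] assms(3) by auto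
next
  let ?\<G> = "{G :: nat ugraph. simple_graph G \<and> G \<rightarrow>\<^sub>e as \<and> clique_number G < R - 2}"
  assume AB: "?A \<or> ?B"
  have low: "enat (R + 6) \<le> ?F"
    unfolding folkman_number_def
  proof (rule INF_greatest)
    fix G :: "nat ugraph" assume "G \<in> ?\<G>"
    then show "enat (R + 6) \<le> enat (card (verts G))"
      using folkman_graph_structure[of G as R] assms(3) by (cases "card (verts G) \<le> R + 6") auto
  qed
  note sg = simple_graph_complete_graph simple_graph_cycle5 simple_graph_graph_Q simple_graph_join
  note cb = clique_bound_complete clique_bound_cycle5 clique_bound_graph_Q
  have cards: "card (verts (complete_graph n)) = n" "card (verts cycle5) = 5" "card (verts graph_Q) = 13" for n
    by (simp_all add: complete_graph_def cycle5_def graph_Q_def)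
  have "\<exists>G\<in>?\<G>. card (verts G) = R + 6"
    using AB
  proof
    assume A: ?A
    let ?H = "complete_graph (R - 7) \<oplus>\<^sub>g graph_Q"
    have "simple_graph ?H" by (intro sg)
    \<comment> \<open>\<open>(R - 7) + 4 = R - 3\<close>; with three pentagons it is
      \<open>(R - 9) + 6\<close>. The bounds on \<open>R\<close> make these subtractions
      exact.\<close>
    moreover have "clique_bound ?H (R - 3)"
      using clique_bound_join[OF sg(1,3) cb(1,3), of "R - 7"] A by simp
    moreover have "card (verts ?H) = R + 6" using A by (simp add: card_verts_join sg cards)
    ultimately show ?thesis using folkman_witness[of ?H R as] A by auto
  next
    assume B: ?B
    let ?H = "complete_graph (R - 9) \<oplus>\<^sub>g cycle5 \<oplus>\<^sub>g cycle5 \<oplus>\<^sub>g cycle5"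
    have "simple_graph ?H" by (intro sg)
    moreover have "clique_bound ?H ((R - 9) + (2 + (2 + 2)))"
      by (intro clique_bound_join sg cb)
    then have "clique_bound ?H (R - 3)" using B by simp
    moreover have "card (verts ?H) = R + 6" using B by (simp add: card_verts_join sg cards)
    ultimately show ?thesis using folkman_witness[of ?H R as] B by auto
  qed
  then obtain G where "G \<in> ?\<G>" "card (verts G) = R + 6" by blast
  then have "?F \<le> enat (R + 6)" unfolding folkman_number_def by (intro INF_lower2[of G]) auto
  then show "?F = enat (R + 6)" using low by (rule antisym)
qed

end
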